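(* There exist a universal constant $c_0>0$ and, for each $\tau\ge1$, a constant $C_\tau>0$ depending only on $\tau$, such that the following holds. Let $(\psi_j)_{j\in\Lambda}$ be an orthonormal system ($\Lambda$ finite or countably infinite) on a domain $\mathcal D$ with orthogonalization measure $\nu$. Let $p\in(0,1]$ and let $\omega=(\omega_j)_{j\in\Lambda}$, $v=(v_j)_{j\in\Lambda}$ be weights satisfying $\omega_j\ge\|\psi_j\|_\infty$ and $v_j\ge2\,\omega_j^{1/(1-p/2)}$. For given $s\in\mathbb N$, let $$\Lambda_0=\Lambda_0^{(s,p)}:=\{j\in\Lambda:\ \omega_jv_j^{1-2/p}\ge s^{1/2-1/p}\},$$ assumed finite and nonempty, and let $N^{(s,p)}=|\Lambda_0|$. Let $\gamma\in(0,1)$ and fix a number of samples $$m\ge c_0\,s\,\max\{\log^3(s)\log(N^{(s,p)}),\ \log(1/\gamma)\}.$$ Suppose that $t_1,\dots,t_m$ are drawn independently at random according to $\nu$. Then with probability exceeding $1-\gamma$ the following holds for all $f=\sum_{j\in\Lambda}x_j\psi_j$ with $|\!|\!|f|\!|\!|_{v,p}<\infty$. Let $y_\ell=f(t_\ell)$, $\ell=1,\dots,m$, and let $A$ be the $m\times N^{(s,p)}$ sampling matrix with entries $A_{\ell,j}=\psi_j(t_\ell)$, $j\in\Lambda_0$. For $\tau\ge1$, let $x^\sharp$ be the solution to $$\min\|z\|_{\omega,1}\quad\text{subject to}\quad\|Az-y\|_2\le\tau\,s^{1/2-1/p}\sqrt m\,|\!|\!|f|\!|\!|_{v,p}$$ and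 set $f^\sharp=\sum_{j\in\Lambda_0}x_j^\sharp\psi_j$. Then $$\|f-f^\sharp\|_\infty\le C_\tau\,s^{1-1/p}\,|\!|\!|f|\!|\!|_{v,p}.$$
   Context: Functions $\psi_j:\mathcal D\to\mathbb C$, $j\in\Lambda$, on a bounded domain $\mathcal D$ form an orthonormal system with orthogonalization measure $\nu$ if $\nu$ is a probability measure on $\mathcal D$ and $\int_{\mathcal D}\psi_j\overline{\psi_k}\,d\nu=\delta_{j,k}$ for all $j,k\in\Lambda$; $\|\cdot\|_\infty$ of a function is the sup norm on $\mathcal D$. Weights always satisfy $\omega_j\ge1$. For a weight $w$, $0<p\le2$ and $x=(x_j)_{j\in\Lambda}$, $\|x\|_{w,p}=\big(\sum_jw_j^{2-p}|x_j|^p\big)^{1/p}$ (in particular $\|z\|_{\omega,1}=\sum_j\omega_j|z_j|$, the sum being over $\Lambda_0$ for vectors indexed by $\Lambda_0$). For $f=\sum_{j\in\Lambda}x_j\psi_j$, $|\!|\!|f|\!|\!|_{w,p}:=\|x\|_{w,p}$. *)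

theory Defs
  imports "HOL-Probability.Probability"
begin

text \<open>
  Points of \<open>R^d\<close> are the functions in \<open>{..<d} \<rightarrow>\<^sub>E UNIV\<close>, so that the dimension is an ordinary
  variable and constants can be asserted to be independent of it. ``Domain'' is meant in the wide
  sense of a set of points: closed cubes and spheres are standard examples, so neither openness nor
  connectedness is required.
\<close>

definition bounded_domain :: "nat \<Rightarrow> (nat \<Rightarrow> real) set \<Rightarrow> bool" where
  "bounded_domain d D \<longleftrightarrow>
     D \<subseteq> {..<d} \<rightarrow>\<^sub>E UNIV \<and> (\<exists>B. \<forall>u\<in>D. \<forall>i<d. \<bar>u i\<bar> \<le> B)"

definition orthonormal_system ::
    "'a set \<Rightarrow> 'a measure \<Rightarrow> 'i set \<Rightarrow> ('i \<Rightarrow> 'a \<Rightarrow> complex) \<Rightarrow> bool" where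
  "orthonormal_system D \<nu> \<Lambda> \<psi> \<longleftrightarrow>
     prob_space \<nu> \<and> space \<nu> = D \<and>
     (\<forall>j\<in>\<Lambda>. \<psi> j \<in> borel_measurable \<nu>) \<and>
     (\<forall>j\<in>\<Lambda>. \<forall>k\<in>\<Lambda>. (\<integral>u. \<psi> j u * cnj (\<psi> k u) \<partial>\<nu>) = (if j = k then 1 else 0))"

text \<open>Valued in \<^typ>\<open>ennreal\<close>, since the real supremum of an unbounded set is unspecified.\<close>

definition sup_norm :: "'a set \<Rightarrow> ('a \<Rightarrow> complex) \<Rightarrow> ennreal" where
  "sup_norm D g = (SUP u\<in>D. ennreal (cmod (g u)))"

definition weight_on :: "'i set \<Rightarrow> ('i \<Rightarrow> real) \<Rightarrow> bool" where
  "weight_on \<Lambda> w \<longleftrightarrow> (\<forall>j\<in>\<Lambda>. w j \<ge> 1)"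

text \<open>
  The value of \<open>weighted_norm\<close> is meaningful only under \<open>weighted_norm_finite\<close>; otherwise
  \<^const>\<open>infsum\<close> returns 0.
\<close>

definition weighted_norm_finite ::
    "'i set \<Rightarrow> ('i \<Rightarrow> real) \<Rightarrow> real \<Rightarrow> ('i \<Rightarrow> complex) \<Rightarrow> bool" where
  "weighted_norm_finite \<Lambda> w p x \<longleftrightarrow>
     (\<lambda>j. w j powr (2 - p) * cmod (x j) powr p) summable_on \<Lambda>"

definition weighted_norm ::
    "'i set \<Rightarrow> ('i \<Rightarrow> real) \<Rightarrow> real \<Rightarrow> ('i \<Rightarrow> complex) \<Rightarrow> real" where
  "weighted_norm \<Lambda> w p x =
     (\<Sum>\<^sub>\<infinity>j\<in>\<Lambda>. w j powr (2 - p) * cmod (x j) powr p) powr (1 / p)"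

definition expansion ::
    "'i set \<Rightarrow> ('i \<Rightarrow> 'a \<Rightarrow> complex) \<Rightarrow> ('i \<Rightarrow> complex) \<Rightarrow> 'a \<Rightarrow> complex" where
  "expansion \<Lambda> \<psi> x u = (\<Sum>\<^sub>\<infinity>j\<in>\<Lambda>. x j * \<psi> j u)"

definition truncated_index_set ::
    "'i set \<Rightarrow> ('i \<Rightarrow> real) \<Rightarrow> ('i \<Rightarrow> real) \<Rightarrow> nat \<Rightarrow> real \<Rightarrow> 'i set" where
  "truncated_index_set \<Lambda> \<omega> v s p =
     {j \<in> \<Lambda>. \<omega> j * v j powr (1 - 2 / p) \<ge> real s powr (1 / 2 - 1 / p)}"

definition sampling_matrix ::
    "('i \<Rightarrow> 'a \<Rightarrow> complex) \<Rightarrow> (nat \<Rightarrow> 'a) \<Rightarrow> nat \<Rightarrow> 'i \<Rightarrow> complex" where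
  "sampling_matrix \<psi> t l j = \<psi> j (t l)"

text \<open>\<open>residual_norm m I A z y\<close> is the Euclidean norm of \<open>A z - y\<close>, where \<open>A\<close> has rows
  \<open>{..<m}\<close> and columns \<open>I\<close>; the entries of \<open>z\<close> outside \<open>I\<close> are irrelevant.\<close>

definition residual_norm ::
    "nat \<Rightarrow> 'i set \<Rightarrow> (nat \<Rightarrow> 'i \<Rightarrow> complex) \<Rightarrow> ('i \<Rightarrow> complex) \<Rightarrow> (nat \<Rightarrow> complex) \<Rightarrow> real" where
  "residual_norm m I A z y = L2_set (\<lambda>l. cmod ((\<Sum>j\<in>I. A l j * z j) - y l)) {..<m}"

text \<open>The minimizer need not be unique, hence a predicate.\<close>

definition is_weighted_l1_solution ::
    "nat \<Rightarrow> 'i set \<Rightarrow> ('i \<Rightarrow> real) \<Rightarrow> (nat \<Rightarrow> 'i \<Rightarrow> complex) \<Rightarrow> (nat \<Rightarrow> complex) \<Rightarrow> real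
      \<Rightarrow> ('i \<Rightarrow> complex) \<Rightarrow> bool" where
  "is_weighted_l1_solution m I \<omega> A y \<eta> x' \<longleftrightarrow>
     is_arg_min (weighted_norm I \<omega> 1) (\<lambda>z. residual_norm m I A z y \<le> \<eta>) x'"

end

theory Submission
  imports Defs
begin

text \<open>
  Write \<open>|x|\<close> for the Euclidean norm on \<open>\<Lambda>\<^sub>0\<close>. The recovery guarantee only needs the one-sided bound
  \<open>|A x|\<^sup>2 \<ge> c m |x|\<^sup>2\<close> on the cone \<open>\<parallel>x\<parallel>\<^sub>\<omega>\<^sub>,\<^sub>1 \<le> 3 sqrt s |x|\<close>: an error vector outside the cone is controlled
  by the best weighted \<open>s\<close>-term approximation, one inside it by the residual.

  For \<open>|x| = 1\<close> the second moment of \<open>f = \<Sum> x j \<psi> j\<close> is, up to constants, the sum over dyadic levels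
  \<open>a\<close> of \<open>a\<^sup>2\<close> times the measure of \<open>{|f| \<ge> a}\<close>. As \<open>f\<close> is \<open>6 sqrt s\<close> times a convex combination of
  the functions \<open>\<plusminus> \<psi> j / \<omega> j\<close>, \<open>\<plusminus> \<i> \<psi> j / \<omega> j\<close> and \<open>0\<close>, Maurey's argument replaces it by an average of about
  \<open>s log s / a\<^sup>2\<close> of them, with an error below \<open>a / 4\<close> outside a set of measure \<open>O (1 / s)\<close>, both for \<open>\<nu>\<close>
  and for the empirical measure. The finitely many averages of each level are handled by a Chernoff
  bound for the lower tail and the union bound, as in the work of Haviv and Regev on subsampled
  Fourier matrices. No chaining is needed because the cost of a level is proportional to \<open>a\<^sup>2\<close> while the
  number of atoms is proportional to \<open>1 / a\<^sup>2\<close>.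
\<close>

section \<open>Lower tails and Maurey approximation\<close>

lemma exp_minus_le:
  fixes x :: real
  assumes "0 \<le> x" "x \<le> 1"
  shows "exp (- x) \<le> 1 - x / 2"
proof -
  have "1 \<le> 1 + x / 2 - x ^ 3 / 4"
    using assms mult_left_le_one_le[of "x" "x*x"] mult_left_le_one_le[of x x]
    by (simp add: power3_eq_cube mult.assoc)
  also have "\<dots> = (1 - x / 2) * (1 + x + x\<^sup>2 / 2)"
    by (simp add: field_simps power2_eq_square power3_eq_cube)
  also have "\<dots> \<le> (1 - x / 2) * exp x"
    using assms exp_lower_Taylor_quadratic[of x] by (intro mult_left_mono) auto
  finally show ?thesis by (simp add: exp_minus field_simps)
qed

lemma exp_le_quadratic:
  fixes y :: real
  assumes "\<bar>y\<bar> \<le> 1"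
  shows "exp y \<le> 1 + y + y\<^sup>2"
proof (cases "0 \<le> y")
  case True
  then show ?thesis using assms exp_bound[of y] by simp
next
  case False
  define z where "z = - y"
  have z: "0 \<le> z" using False by (simp add: z_def)
  have "0 \<le> (z - 1/2)\<^sup>2" by simp
  then have q: "0 \<le> 1 - z + z\<^sup>2" by (simp add: power2_eq_square algebra_simps)
  \<comment> \<open>The claim amounts to \<open>1 \<le> (1 - z + z\<^sup>2) * exp z\<close>. With
    \<open>exp z\<close> replaced by its quadratic Taylor polynomial the linear terms cancel and
    only nonnegative coefficients remain.\<close>
  have "1 \<le> 1 + z^2 / 2 + z^3 / 2 + z^4 / 2" using z by simp
  also have "\<dots> = (1 - z + z\<^sup>2) * (1 + z + z\<^sup>2 / 2)"
    by (simp add: field_simps power2_eq_square power3_eq_cube power4_eq_xxxx)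
  also have "\<dots> \<le> (1 - z + z\<^sup>2) * exp z"
    using z q exp_lower_Taylor_quadratic[of z] by (intro mult_left_mono) auto
  finally have "exp (- z) \<le> 1 - z + z\<^sup>2" by (simp add: exp_minus field_simps)
  then show ?thesis by (simp add: z_def)
qed

text \<open>Centring cancels the linear term of \<open>exp_le_quadratic\<close>, and the variance is
  at most the second moment, hence at most 1. Centred values have modulus at most 2, so
  \<open>l \<le> 1 / 2\<close> keeps the exponent within \<open>[-1, 1]\<close>.\<close>

lemma finite_mgf_le:
  fixes X p :: "'b \<Rightarrow> real"
  assumes "finite B" "\<And>b. b \<in> B \<Longrightarrow> 0 \<le> p b" "sum p B = 1"
    and "\<And>b. b \<in> B \<Longrightarrow> \<bar>X b\<bar> \<le> 1" and l: "0 \<le> l" "l \<le> 1 / 2"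
  shows "(\<Sum>b\<in>B. p b * exp (l * (X b - (\<Sum>b\<in>B. p b * X b)))) \<le> 1 + l\<^sup>2"
proof -
  define a where "a = (\<Sum>b\<in>B. p b * X b)"
  have "\<bar>a\<bar> \<le> (\<Sum>b\<in>B. p b * 1)"
    unfolding a_def
    by (intro order_trans[OF sum_abs] sum_mono) (auto simp: abs_mult assms intro!: mult_left_le)
  then have a: "\<bar>a\<bar> \<le> 1" using assms by simp
  have "(\<Sum>b\<in>B. p b * exp (l * (X b - a))) \<le> (\<Sum>b\<in>B. p b * (1 + l * (X b - a) + (l * (X b - a))\<^sup>2))"
  proof (intro sum_mono mult_left_mono exp_le_quadratic)
    fix b assume b: "b \<in> B"
    have "\<bar>l * (X b - a)\<bar> \<le> 1 / 2 * 2"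
      unfolding abs_mult using a assms(4)[OF b] l by (intro mult_mono) auto
    then show "\<bar>l * (X b - a)\<bar> \<le> 1" by simp
  qed (use assms in auto)
  also have "\<dots> = (\<Sum>b\<in>B. p b * (1 - l * a + l\<^sup>2 * a\<^sup>2) + (l - 2 * l\<^sup>2 * a) * (p b * X b) + l\<^sup>2 * (p b * (X b)\<^sup>2))"
    by (intro sum.cong) (auto simp: power2_eq_square algebra_simps)
  also have "\<dots> = (1 - l * a + l\<^sup>2 * a\<^sup>2) + (l - 2 * l\<^sup>2 * a) * a + l\<^sup>2 * (\<Sum>b\<in>B. p b * (X b)\<^sup>2)"
    by (simp add: sum.distrib sum_distrib_left[symmetric] sum_distrib_right[symmetric] assms a_def)
  also have "\<dots> = 1 - (l * a)\<^sup>2 + l\<^sup>2 * (\<Sum>b\<in>B. p b * (X b)\<^sup>2)"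
    by (simp add: power2_eq_square algebra_simps)
  also have "\<dots> \<le> 1 - 0 + l\<^sup>2 * (\<Sum>b\<in>B. p b * 1)"
    using assms by (intro add_mono diff_mono mult_left_mono sum_mono) (auto simp: abs_square_le_1)
  finally show ?thesis using assms by (simp add: a_def)
qed

text \<open>Chernoff's method with parameter 1: convexity gives mean at most
  \<open>exp (- q / 2)\<close> for \<open>exp (- X)\<close>, where \<open>q\<close> is the mean of
  \<open>X\<close>. Settling for half of the mean makes the failure probability depend on
  \<open>m * \<theta>\<close> alone.\<close>

lemma iid_lower_tail:
  fixes M :: "'a measure" and X :: "'a \<Rightarrow> real" and m :: nat and \<theta> :: real
  assumes M: "prob_space M" and X[measurable]: "X \<in> borel_measurable M"
    and X01: "\<And>u. u \<in> space M \<Longrightarrow> 0 \<le> X u \<and> X u \<le> 1"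
  shows "measure (Pi\<^sub>M {..<m} (\<lambda>_. M))
      {t \<in> space (Pi\<^sub>M {..<m} (\<lambda>_. M)). (\<Sum>l<m. X (t l)) \<le> m * (\<integral>u. X u \<partial>M) / 2 - m * \<theta>}
    \<le> exp (- (m * \<theta>))"
proof -
  let ?P = "Pi\<^sub>M {..<m} (\<lambda>_. M)"
  define q where "q = (\<integral>u. X u \<partial>M)"
  interpret M: prob_space M by fact
  have P: "product_sigma_finite (\<lambda>_::nat. M)"
    by (simp add: product_sigma_finite_def M.sigma_finite_measure_axioms)
  have intX: "integrable M X"
    using X01 by (intro M.integrable_const_bound[where B=1]) (auto intro!: AE_I2)
  have intE: "integrable M (\<lambda>u. exp (- X u))"
    using X01 by (intro M.integrable_const_bound[where B=1]) (auto intro!: AE_I2)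
  have E: "(\<integral>u. exp (- X u) \<partial>M) \<le> exp (- q / 2)"
  proof -
    have "(\<integral>u. exp (- X u) \<partial>M) \<le> (\<integral>u. 1 - X u / 2 \<partial>M)"
      using X01 intX intE by (intro integral_mono) (auto intro!: exp_minus_le)
    also have "\<dots> = 1 - q / 2" using intX by (simp add: q_def M.prob_space)
    also have "\<dots> \<le> exp (- q / 2)" using exp_ge_add_one_self[of "- q / 2"] by simp
    finally show ?thesis .
  qed
  define Y where "Y = (\<lambda>t. \<Prod>l<m. exp (- X (t l)))"
  have Y: "Y t = exp (- (\<Sum>l<m. X (t l)))" for t
    using exp_sum[OF finite_lessThan, of "\<lambda>l. - X (t l)" m] by (simp add: Y_def sum_negf)
  have intY: "integrable ?P Y"
    unfolding Y_def by (intro product_sigma_finite.product_integrable_prod[OF P]) (auto intro: intE)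
  have "(\<integral>t. Y t \<partial>?P) = (\<integral>u. exp (- X u) \<partial>M) ^ m"
    unfolding Y_def by (subst product_sigma_finite.product_integral_prod[OF P]) (auto intro: intE)
  also have "\<dots> \<le> exp (- q / 2) ^ m"
    by (intro power_mono E integral_nonneg) auto
  also have "\<dots> = exp (- (m * q / 2))" by (simp add: exp_of_nat_mult[symmetric])
  finally have EY: "(\<integral>t. Y t \<partial>?P) \<le> exp (- (m * q / 2))" .
  define c where "c = exp (- (m * q / 2 - m * \<theta>))"
  have "measure ?P {t \<in> space ?P. c \<le> Y t} \<le> (\<integral>t. Y t \<partial>?P) / c"
    by (rule integral_Markov_inequality_measure[OF intY, of "{}"]) (auto simp: c_def Y)
  also have "\<dots> \<le> exp (- (m * q / 2)) / c"
    using EY by (intro divide_right_mono) (auto simp: c_def)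
  also have "\<dots> = exp (- (m * \<theta>))"
    by (simp add: c_def exp_diff[symmetric])
  also have "{t \<in> space ?P. c \<le> Y t} = {t \<in> space ?P. (\<Sum>l<m. X (t l)) \<le> m * q / 2 - m * \<theta>}"
    by (auto simp: c_def Y)
  finally show ?thesis by (simp add: q_def)
qed

text \<open>Adding population and empirical mean lets a single choice of atoms serve both. For a
  probability measure and \<open>m > 0\<close> the total mass is 2.\<close>

definition mixed_mean :: "'a measure \<Rightarrow> nat \<Rightarrow> (nat \<Rightarrow> 'a) \<Rightarrow> ('a \<Rightarrow> real) \<Rightarrow> real" where
  "mixed_mean M m t g = (\<integral>u. g u \<partial>M) + (\<Sum>l<m. g (t l)) / m"

lemma mixed_mean_mono:
  assumes "integrable M g" "integrable M h" "\<And>u. u \<in> space M \<Longrightarrow> g u \<le> h u"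
    and "\<And>l. l < m \<Longrightarrow> t l \<in> space M"
  shows "mixed_mean M m t g \<le> mixed_mean M m t h"
  unfolding mixed_mean_def using assms
  by (intro add_mono integral_mono divide_right_mono sum_mono) auto

lemma mixed_mean_sum:
  assumes "\<And>b. b \<in> B \<Longrightarrow> integrable M (g b)"
  shows "mixed_mean M m t (\<lambda>u. \<Sum>b\<in>B. p b * g b u) = (\<Sum>b\<in>B. p b * mixed_mean M m t (g b))"
proof -
  have "(\<Sum>l<m. \<Sum>b\<in>B. p b * g b (t l)) = (\<Sum>b\<in>B. p b * (\<Sum>l<m. g b (t l)))"
    by (subst sum.swap) (simp add: sum_distrib_left)
  then show ?thesis
    using assms
    by (simp add: mixed_mean_def algebra_simps sum.distrib sum_divide_distrib sum_distrib_left)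
qed

lemma mixed_mean_cmult:
  "mixed_mean M m t (\<lambda>u. c * g u) = c * mixed_mean M m t g"
  by (simp add: mixed_mean_def algebra_simps sum_distrib_left[symmetric])

section \<open>Maurey sampling made greedy by an exponential potential\<close>

definition atom_sum :: "('b \<Rightarrow> 'a \<Rightarrow> complex) \<Rightarrow> 'b list \<Rightarrow> 'a \<Rightarrow> complex" where
  "atom_sum g bs u = (\<Sum>b\<leftarrow>bs. g b u)"

lemma atom_sum_measurable:
  assumes "\<And>b. b \<in> set bs \<Longrightarrow> g b \<in> borel_measurable M"
  shows "atom_sum g bs \<in> borel_measurable M"
proof -
  have "(\<lambda>u. \<Sum>b\<leftarrow>bs. g b u) \<in> borel_measurable M"
    using assms by (induction bs) auto
  then show ?thesis by (simp add: atom_sum_def[abs_def])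
qed

lemma norm_atom_sum_le:
  assumes "\<And>b. b \<in> set bs \<Longrightarrow> cmod (g b u) \<le> 1"
  shows "cmod (atom_sum g bs u) \<le> length bs"
  using assms
proof (induction bs)
  case (Cons b bs)
  then have "cmod (atom_sum g bs u) \<le> length bs" "cmod (g b u) \<le> 1" by auto
  then show ?case
    using norm_triangle_ineq[of "g b u" "atom_sum g bs u"] by (simp add: atom_sum_def)
qed (simp add: atom_sum_def)

text \<open>The four unit directions turn a large modulus of the complex deviation into a large real
  part, so real exponential moments suffice.\<close>

definition dev_potential ::
    "('b \<Rightarrow> 'a \<Rightarrow> complex) \<Rightarrow> ('a \<Rightarrow> complex) \<Rightarrow> real \<Rightarrow> 'b list \<Rightarrow> 'a \<Rightarrow> real" where
  "dev_potential g f l bs u =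
     (\<Sum>c\<in>{1, -1, \<i>, -\<i>}. exp (l * Re (c * (atom_sum g bs u - of_nat (length bs) * f u))))"

lemma convex_combination_le_one:
  fixes g :: "'b \<Rightarrow> complex"
  assumes "finite B" "\<And>b. b \<in> B \<Longrightarrow> 0 \<le> p b" "sum p B = 1" "\<And>b. b \<in> B \<Longrightarrow> cmod (g b) \<le> 1"
  shows "cmod (\<Sum>b\<in>B. of_real (p b) * g b) \<le> 1"
proof -
  have "cmod (\<Sum>b\<in>B. of_real (p b) * g b) \<le> (\<Sum>b\<in>B. p b * 1)"
    by (intro order_trans[OF norm_sum] sum_mono) (auto simp: norm_mult assms intro!: mult_left_le)
  then show ?thesis using assms by simp
qed

lemma pigeonhole_convex:
  fixes y :: "'b \<Rightarrow> real"
  assumes "finite B" "\<And>b. b \<in> B \<Longrightarrow> 0 \<le> p b" "sum p B = 1" "(\<Sum>b\<in>B. p b * y b) \<le> c"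
  shows "\<exists>b\<in>B. y b \<le> c"
proof (rule ccontr)
  assume "\<not> ?thesis"
  then have gt: "c < y b" if "b \<in> B" for b using that by force
  obtain b0 where "b0 \<in> B" "p b0 \<noteq> 0" using assms(3) by (metis sum.neutral zero_neq_one)
  have "p b0 * c < p b0 * y b0"
    using gt[of b0] assms(2)[of b0] \<open>b0 \<in> B\<close> \<open>p b0 \<noteq> 0\<close> by (intro mult_strict_left_mono) auto
  then have "(\<Sum>b\<in>B. p b * c) < (\<Sum>b\<in>B. p b * y b)"
    using assms(1,2) gt \<open>b0 \<in> B\<close>
    by (intro sum_strict_mono_ex1) (auto simp: less_imp_le mult_left_mono)
  then show False using assms by (simp add: sum_distrib_right[symmetric])
qed

lemma integrable_dev_potential:
  fixes g :: "'b \<Rightarrow> 'a \<Rightarrow> complex"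
  assumes M: "prob_space M"
    and gm[measurable]: "\<And>b. b \<in> set bs \<Longrightarrow> g b \<in> borel_measurable M"
    and g1: "\<And>b u. b \<in> set bs \<Longrightarrow> u \<in> space M \<Longrightarrow> cmod (g b u) \<le> 1"
    and fm[measurable]: "f \<in> borel_measurable M"
    and f1: "\<And>u. u \<in> space M \<Longrightarrow> cmod (f u) \<le> 1"
    and l: "0 \<le> l" "l \<le> 1"
  shows "integrable M (dev_potential g f l bs)"
proof -
  interpret prob_space M by fact
  show ?thesis
    unfolding dev_potential_def
  proof (intro Bochner_Integration.integrable_sum integrable_const_bound[where B="exp (2 * length bs)"] AE_I2)
    fix c :: complex and u assume c: "c \<in> {1, -1, \<i>, -\<i>}" and u: "u \<in> space M"
    have c1: "cmod c = 1" using c by auto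
    let ?z = "c * (atom_sum g bs u - of_nat (length bs) * f u)"
    have "cmod ?z \<le> cmod (atom_sum g bs u) + cmod (of_nat (length bs) * f u)"
      unfolding norm_mult[of c] c1 mult_1 by (rule norm_triangle_ineq4)
    also have "\<dots> \<le> real (length bs) + real (length bs) * 1"
      using g1 f1 u by (intro add_mono norm_atom_sum_le) (auto simp: norm_mult intro!: mult_left_le)
    finally have "\<bar>Re ?z\<bar> \<le> 2 * length bs" using abs_Re_le_cmod[of ?z] by linarith
    then have "l * \<bar>Re ?z\<bar> \<le> 1 * real (2 * length bs)"
      using l by (intro mult_mono) auto
    moreover have "l * Re ?z \<le> l * \<bar>Re ?z\<bar>" using l by (intro mult_left_mono) auto
    ultimately have "l * Re ?z \<le> 2 * length bs" by simp
    then show "norm (exp (l * Re ?z)) \<le> exp (2 * length bs)" by simp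
  next
    have [measurable]: "atom_sum g bs \<in> borel_measurable M"
      by (intro atom_sum_measurable gm)
    fix c :: complex
    show "(\<lambda>u. exp (l * Re (c * (atom_sum g bs u - of_nat (length bs) * f u)))) \<in> borel_measurable M"
      by measurable
  qed
qed

text \<open>Choosing the atoms one at a time so that the exponential potential does not exceed its mean
  replaces the random sampling in Maurey's argument.\<close>

lemma maurey_potential:
  fixes g :: "'b \<Rightarrow> 'a \<Rightarrow> complex"
  assumes M: "prob_space M" and t: "\<And>l. l < m \<Longrightarrow> t l \<in> space M" and m: "m > 0"
    and B: "finite B" "\<And>b. b \<in> B \<Longrightarrow> 0 \<le> p b" "sum p B = 1"
    and gm[measurable]: "\<And>b. b \<in> B \<Longrightarrow> g b \<in> borel_measurable M"
    and g1: "\<And>b u. b \<in> B \<Longrightarrow> u \<in> space M \<Longrightarrow> cmod (g b u) \<le> 1"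
    and l: "0 \<le> l" "l \<le> 1 / 2"
  defines "f \<equiv> \<lambda>u. \<Sum>b\<in>B. of_real (p b) * g b u"
  shows "\<exists>bs. set bs \<subseteq> B \<and> length bs = k \<and> mixed_mean M m t (dev_potential g f l bs) \<le> 8 * (1 + l\<^sup>2) ^ k"
proof -
  interpret prob_space M by fact
  have fm[measurable]: "f \<in> borel_measurable M" unfolding f_def by measurable
  have f1: "cmod (f u) \<le> 1" if "u \<in> space M" for u
    unfolding f_def using that by (intro convex_combination_le_one B g1)
  have int: "integrable M (dev_potential g f l bs)" if "set bs \<subseteq> B" for bs
    using that l by (intro integrable_dev_potential prob_space_axioms g1 f1) auto
  show ?thesis
  proof (induction k)
    case 0
    \<comment> \<open>Four exponentials of 0, integrated against total mass 2, give the initial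
      value 8.\<close>
    have "dev_potential g f l [] = (\<lambda>u. 4)"
      by (auto simp: dev_potential_def atom_sum_def complex_eq_iff)
    then have "mixed_mean M m t (dev_potential g f l []) = 8"
      using m by (simp add: mixed_mean_def prob_space)
    then show ?case by (intro exI[of _ "[]"]) simp
  next
    case (Suc k)
    then obtain bs where bs: "set bs \<subseteq> B" "length bs = k"
      and le: "mixed_mean M m t (dev_potential g f l bs) \<le> 8 * (1 + l\<^sup>2) ^ k" by blast
    \<comment> \<open>Prepending an atom drawn with law \<open>p\<close> multiplies each exponential
      by a centred moment generating function, because \<open>Re (c * g b u)\<close> has mean
      \<open>Re (c * f u)\<close>.\<close>
    have pw: "(\<Sum>b\<in>B. p b * dev_potential g f l (b # bs) u) \<le> (1 + l\<^sup>2) * dev_potential g f l bs u"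
      if u: "u \<in> space M" for u
    proof -
      let ?e = "\<lambda>c. exp (l * Re (c * (atom_sum g bs u - of_nat k * f u)))"
      have "(\<Sum>b\<in>B. p b * dev_potential g f l (b # bs) u)
          = (\<Sum>b\<in>B. \<Sum>c\<in>{1, -1, \<i>, -\<i>}. ?e c * (p b * exp (l * (Re (c * g b u) - Re (c * f u)))))"
        unfolding dev_potential_def sum_distrib_left
        by (intro sum.cong refl)
           (simp add: bs atom_sum_def exp_add[symmetric] algebra_simps)
      also have "\<dots> = (\<Sum>c\<in>{1, -1, \<i>, -\<i>}. ?e c * (\<Sum>b\<in>B. p b * exp (l * (Re (c * g b u) - Re (c * f u)))))"
        by (subst sum.swap) (simp only: sum_distrib_left)
      also have "\<dots> \<le> (\<Sum>c\<in>{1, -1, \<i>, -\<i>}. ?e c * (1 + l\<^sup>2))"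
      proof (intro sum_mono mult_left_mono)
        fix c :: complex assume "c \<in> {1, -1, \<i>, -\<i>}"
        then have c1: "cmod c = 1" by auto
        have "Re (c * f u) = (\<Sum>b\<in>B. p b * Re (c * g b u))"
          unfolding f_def sum_distrib_left Re_sum by (intro sum.cong refl) (simp add: algebra_simps)
        moreover have "\<bar>Re (c * g b u)\<bar> \<le> 1" if "b \<in> B" for b
          using abs_Re_le_cmod[of "c * g b u"] g1[OF that u] by (simp add: norm_mult c1)
        ultimately show "(\<Sum>b\<in>B. p b * exp (l * (Re (c * g b u) - Re (c * f u)))) \<le> 1 + l\<^sup>2"
          using finite_mgf_le[of B p "\<lambda>b. Re (c * g b u)" l] B l by simp
      qed auto
      also have "\<dots> = (1 + l\<^sup>2) * dev_potential g f l bs u"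
        unfolding dev_potential_def bs sum_distrib_left by (intro sum.cong refl) (simp add: algebra_simps)
      finally show ?thesis .
    qed
    have ib: "integrable M (dev_potential g f l (b # bs))" if "b \<in> B" for b
      using that bs by (intro int) auto
    have "(\<Sum>b\<in>B. p b * mixed_mean M m t (dev_potential g f l (b # bs)))
        = mixed_mean M m t (\<lambda>u. \<Sum>b\<in>B. p b * dev_potential g f l (b # bs) u)"
      using ib by (intro mixed_mean_sum[symmetric])
    also have "\<dots> \<le> mixed_mean M m t (\<lambda>u. (1 + l\<^sup>2) * dev_potential g f l bs u)"
      using ib bs int t pw by (intro mixed_mean_mono) auto
    also have "\<dots> = (1 + l\<^sup>2) * mixed_mean M m t (dev_potential g f l bs)"
      by (rule mixed_mean_cmult)
    also have "\<dots> \<le> (1 + l\<^sup>2) * (8 * (1 + l\<^sup>2) ^ k)"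
      using le by (intro mult_left_mono) auto
    finally have "(\<Sum>b\<in>B. p b * mixed_mean M m t (dev_potential g f l (b # bs))) \<le> 8 * (1 + l\<^sup>2) ^ Suc k"
      by (simp add: algebra_simps)
    from pigeonhole_convex[OF B this] obtain b where
      "b \<in> B" "mixed_mean M m t (dev_potential g f l (b # bs)) \<le> 8 * (1 + l\<^sup>2) ^ Suc k" by blast
    then show ?case using bs by (intro exI[of _ "b # bs"]) auto
  qed
qed

section \<open>Dyadic levels\<close>

definition exceeds :: "('a \<Rightarrow> complex) \<Rightarrow> real \<Rightarrow> 'a \<Rightarrow> real" where
  "exceeds F a u = (if a \<le> cmod (F u) then 1 else 0)"

lemma exceeds_nonneg: "0 \<le> exceeds F a u"
  by (simp add: exceeds_def)

lemma exceeds_measurable [measurable]: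
  "F \<in> borel_measurable M \<Longrightarrow> exceeds F a \<in> borel_measurable M"
  unfolding exceeds_def[abs_def] by measurable

lemma integrable_exceeds:
  assumes "prob_space M" "F \<in> borel_measurable M"
  shows "integrable M (exceeds F a)"
proof -
  interpret prob_space M by fact
  show ?thesis
    using assms by (intro integrable_const_bound[where B=1]) (auto simp: exceeds_def)
qed

lemma direction_of_large_modulus:
  assumes "2 * r \<le> cmod z"
  shows "\<exists>c\<in>{1, -1, \<i>, -\<i>}. r \<le> Re (c * z)"
proof -
  have "2 * r \<le> \<bar>Re z\<bar> + \<bar>Im z\<bar>" using cmod_le[of z] assms by linarith
  then show ?thesis by auto
qed

text \<open>Markov's inequality for the potential: it is at least
  \<open>exp (2 * k * l\<^sup>2)\<close> wherever the deviation reaches \<open>a / 4\<close>, while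
  its mixed mean is at most \<open>8 * exp (k * l\<^sup>2)\<close>.\<close>

lemma maurey_approximation:
  fixes g :: "'b \<Rightarrow> 'a \<Rightarrow> complex"
  assumes M: "prob_space M" and t: "\<And>l. l < m \<Longrightarrow> t l \<in> space M" and m: "m > 0"
    and B: "finite B" "\<And>b. b \<in> B \<Longrightarrow> 0 \<le> p b" "sum p B = 1"
    and gm[measurable]: "\<And>b. b \<in> B \<Longrightarrow> g b \<in> borel_measurable M"
    and g1: "\<And>b u. b \<in> B \<Longrightarrow> u \<in> space M \<Longrightarrow> cmod (g b u) \<le> 1"
    and F: "\<And>u. F u = of_real R * (\<Sum>b\<in>B. of_real (p b) * g b u)"
    and a: "0 < a" "a \<le> 8 * R"
    and k: "k > 0" "8 * exp (- (k * a\<^sup>2 / (256 * R\<^sup>2))) \<le> \<delta>"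
  shows "\<exists>bs. set bs \<subseteq> B \<and> length bs = k \<and>
    mixed_mean M m t (exceeds (\<lambda>u. of_real (R / k) * atom_sum g bs u - F u) (a / 4)) \<le> \<delta>"
proof -
  interpret prob_space M by fact
  define f where "f = (\<lambda>u. \<Sum>b\<in>B. of_real (p b) * g b u)"
  \<comment> \<open>This value maximizes the exponent
    \<open>l * (k * a / (8 * R)) - k * l\<^sup>2\<close>; the condition \<open>a \<le> 8 * R\<close>
    is what makes it at most \<open>1 / 2\<close>.\<close>
  define l where "l = a / (16 * R)"
  have Ff: "F u = of_real R * f u" for u by (simp add: F f_def)
  have R: "R > 0" using a by simp
  have l: "0 \<le> l" "l \<le> 1 / 2" using a R by (auto simp: l_def field_simps)
  have "\<exists>bs. set bs \<subseteq> B \<and> length bs = k \<and> mixed_mean M m t (dev_potential g f l bs) \<le> 8 * (1 + l\<^sup>2) ^ k"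
    unfolding f_def by (rule maurey_potential) (use assms l in auto)
  then obtain bs where bs: "set bs \<subseteq> B" "length bs = k"
    and pot: "mixed_mean M m t (dev_potential g f l bs) \<le> 8 * (1 + l\<^sup>2) ^ k"
    by blast
  have fm[measurable]: "f \<in> borel_measurable M" unfolding f_def by measurable
  have f1: "cmod (f u) \<le> 1" if "u \<in> space M" for u
    unfolding f_def using that by (intro convex_combination_le_one B g1)
  have sm[measurable]: "atom_sum g bs \<in> borel_measurable M"
    using bs gm by (intro atom_sum_measurable) auto
  have Fm[measurable]: "F \<in> borel_measurable M"
    unfolding Ff[abs_def] by measurable
  let ?D = "\<lambda>u. of_real (R / k) * atom_sum g bs u - F u"
  define e where "e = exp (2 * k * l\<^sup>2)"
  have pw: "e * exceeds ?D (a / 4) u \<le> dev_potential g f l bs u" for u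
  proof (cases "a / 4 \<le> cmod (?D u)")
    case True
    let ?z = "atom_sum g bs u - of_nat k * f u"
    have "?D u = of_real (R / k) * ?z"
      using k by (simp add: Ff algebra_simps)
    then have "cmod (?D u) = R / k * cmod ?z"
      using R k by (simp only: norm_mult norm_of_real) simp
    with True have "a / 4 \<le> R / k * cmod ?z" by (simp only:)
    \<comment> \<open>By the choice of \<open>l\<close>, \<open>k * a / (4 * R) = 4 * k * l\<close>;
      passing to one of the four directions loses a factor 2.\<close>
    then have "2 * (k * (2 * l)) \<le> cmod ?z"
      using R k(1) by (simp add: l_def field_simps)
    then obtain c where c: "c \<in> {1, -1, \<i>, -\<i>}" "k * (2 * l) \<le> Re (c * ?z)"
      using direction_of_large_modulus by blast
    have "e = exp (l * (k * (2 * l)))" by (simp add: e_def power2_eq_square algebra_simps)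
    also have "\<dots> \<le> exp (l * Re (c * ?z))" using c l by (simp add: mult_left_mono)
    also have "\<dots> \<le> dev_potential g f l bs u"
      unfolding dev_potential_def bs using c by (intro member_le_sum) auto
    finally show ?thesis using True by (simp add: exceeds_def)
  next
    case False
    then show ?thesis by (auto simp: exceeds_def dev_potential_def intro!: sum_nonneg)
  qed
  have "e * mixed_mean M m t (exceeds ?D (a / 4)) = mixed_mean M m t (\<lambda>u. e * exceeds ?D (a / 4) u)"
    by (simp add: mixed_mean_cmult)
  also have "\<dots> \<le> mixed_mean M m t (dev_potential g f l bs)"
  proof (intro mixed_mean_mono pw t)
    show "integrable M (\<lambda>u. e * exceeds ?D (a / 4) u)"
      by (intro integrable_mult_right integrable_exceeds M) measurable
    show "integrable M (dev_potential g f l bs)"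
      using bs l by (intro integrable_dev_potential M gm g1 f1) auto
  qed
  also have "\<dots> \<le> 8 * exp (l\<^sup>2) ^ k"
    using exp_ge_add_one_self[of "l\<^sup>2"]
    by (intro order_trans[OF pot] mult_left_mono power_mono) (auto intro: add_nonneg_nonneg)
  also have "\<dots> = e * (8 * exp (- (k * l\<^sup>2)))"
    by (simp add: e_def exp_of_nat_mult[symmetric] exp_minus exp_double[symmetric] field_simps exp_add[symmetric])
  also have "\<dots> \<le> e * \<delta>"
    using k by (intro mult_left_mono) (auto simp: e_def l_def power_divide power_mult_distrib)
  finally have "mixed_mean M m t (exceeds ?D (a / 4)) \<le> \<delta>"
    by (simp add: e_def)
  with bs show ?thesis by blast
qed

text \<open>The approximation \<open>h\<close> stands between two levels of \<open>F\<close>: off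
  the bad set, \<open>a \<le> cmod (F u)\<close> forces \<open>3 * a / 4 \<le> cmod (h u)\<close>,
  which in turn forces \<open>a / 2 \<le> cmod (F u)\<close>. The bad set is paid for once under
  \<open>M\<close> and once on the sample.\<close>

lemma level_count_transfer:
  fixes F h :: "'a \<Rightarrow> complex"
  assumes M: "prob_space M" and t: "\<And>l. l < m \<Longrightarrow> t l \<in> space M" and m: "m > 0"
    and [measurable]: "F \<in> borel_measurable M" "h \<in> borel_measurable M"
    and bad: "mixed_mean M m t (exceeds (\<lambda>u. h u - F u) (a / 4)) \<le> \<delta>"
    and h: "m * (\<integral>u. exceeds h (3 * a / 4) u \<partial>M) / 2 - m * \<theta> < (\<Sum>l<m. exceeds h (3 * a / 4) (t l))"
  shows "m * ((\<integral>u. exceeds F a u \<partial>M) / 2 - \<theta> - \<delta>) \<le> (\<Sum>l<m. exceeds F (a / 2) (t l))"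
proof -
  let ?b = "exceeds (\<lambda>u. h u - F u) (a / 4)"
  note int = integrable_exceeds[OF M]
  have tri: "cmod (F u) \<le> cmod (h u) + cmod (h u - F u)" "cmod (h u) \<le> cmod (F u) + cmod (h u - F u)" for u
    using norm_triangle_ineq4[of "h u" "h u - F u"] norm_triangle_ineq[of "F u" "h u - F u"] by simp_all
  define e where "e = (\<integral>u. ?b u \<partial>M)"
  define e' where "e' = (\<Sum>l<m. ?b (t l))"
  have e: "0 \<le> e" unfolding e_def by (intro Bochner_Integration.integral_nonneg exceeds_nonneg)
  have ee: "e + e' / m \<le> \<delta>" using bad by (simp add: mixed_mean_def e_def e'_def)
  then have ee: "m * e + e' \<le> m * \<delta>" using m by (simp add: field_simps)
  have "(\<integral>u. exceeds F a u \<partial>M) \<le> (\<integral>u. exceeds h (3 * a / 4) u + ?b u \<partial>M)"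
  proof (intro integral_mono Bochner_Integration.integrable_add int)
    fix u show "exceeds F a u \<le> exceeds h (3 * a / 4) u + ?b u"
      using tri[of u] by (auto simp: exceeds_def)
  qed measurable
  also have "\<dots> = (\<integral>u. exceeds h (3 * a / 4) u \<partial>M) + e"
    unfolding e_def by (intro Bochner_Integration.integral_add int) measurable
  finally have 1: "m * (\<integral>u. exceeds F a u \<partial>M) \<le> m * ((\<integral>u. exceeds h (3 * a / 4) u \<partial>M) + e)"
    by (intro mult_left_mono) auto
  have "(\<Sum>l<m. exceeds h (3 * a / 4) (t l)) \<le> (\<Sum>l<m. exceeds F (a / 2) (t l) + ?b (t l))"
  proof (intro sum_mono)
    fix l show "exceeds h (3 * a / 4) (t l) \<le> exceeds F (a / 2) (t l) + ?b (t l)"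
      using tri[of "t l"] by (auto simp: exceeds_def)
  qed
  then have 2: "(\<Sum>l<m. exceeds h (3 * a / 4) (t l)) \<le> (\<Sum>l<m. exceeds F (a / 2) (t l)) + e'"
    by (simp add: sum.distrib e'_def)
  \<comment> \<open>The population error enters only as \<open>m * e / 2\<close>; nonnegativity
    allows it to be replaced by \<open>m * e\<close>, as in the bound on
    \<open>m * e + e'\<close>.\<close>
  have "0 \<le> m * e" using e by simp
  then show ?thesis using 1 2 ee h by (simp add: algebra_simps)
qed

text \<open>Values below \<open>1 / 2\<close> are covered by the constant \<open>1 / 4\<close>.
  Otherwise the highest level not above \<open>y\<close> exceeds \<open>y / 2\<close>, and its
  summand alone suffices.\<close>

lemma dyadic_upper:
  fixes y :: real
  assumes "0 \<le> y" "y < 2 ^ L / 2"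
  shows "y\<^sup>2 \<le> 1 / 4 + 4 * (\<Sum>i<L. (2 ^ i / 2)\<^sup>2 * (if 2 ^ i / 2 \<le> y then 1 else 0))"
  using assms
proof (induction L)
  case 0
  then have "y\<^sup>2 \<le> (1 / 2)\<^sup>2" by (intro power_mono) auto
  then show ?case by (simp add: power2_eq_square)
next
  case (Suc L)
  show ?case
  proof (cases "2 ^ L / 2 \<le> y")
    case True
    have "y\<^sup>2 \<le> (2 ^ L)\<^sup>2" using Suc.prems by (intro power_mono) auto
    also have "\<dots> = 4 * (2 ^ L / 2)\<^sup>2" by (simp add: power_divide)
    also have "\<dots> \<le> 4 * (\<Sum>i<Suc L. (2 ^ i / 2)\<^sup>2 * (if 2 ^ i / 2 \<le> y then 1 else 0))"
      using True by (auto intro!: sum_nonneg)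
    finally show ?thesis by simp
  next
    case False
    with Suc show ?thesis by simp
  qed
qed

lemma square_power_two: "(2 ^ i :: real)\<^sup>2 = 4 ^ i"
  by (simp add: power2_eq_square power_mult_distrib[symmetric])

lemma sum_dyadic_squares: "(\<Sum>i<L. (2 ^ i / 2 :: real)\<^sup>2) = (4 ^ L - 1) / 12"
  by (induction L) (auto simp: power_divide square_power_two field_simps)

text \<open>The sum is geometric and so is controlled by its largest active level. The indicators
  use half the level, matching the loss from \<open>a\<close> to \<open>a / 2\<close> in
  \<open>level_count_transfer\<close>.\<close>

lemma dyadic_lower:
  fixes y :: real
  assumes "0 \<le> y"
  shows "(\<Sum>i<L. (2 ^ i / 2)\<^sup>2 * (if 2 ^ i / 2 / 2 \<le> y then 1 else 0)) \<le> 16 / 3 * y\<^sup>2"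
proof (induction L)
  case (Suc L)
  show ?case
  proof (cases "2 ^ L / 2 / 2 \<le> y")
    case True
    have "(\<Sum>i<Suc L. (2 ^ i / 2)\<^sup>2 * (if 2 ^ i / 2 / 2 \<le> y then 1 else 0)) \<le> (\<Sum>i<Suc L. (2 ^ i / 2 :: real)\<^sup>2)"
      by (intro sum_mono) auto
    also have "\<dots> = (4 ^ Suc L - 1) / 12" by (rule sum_dyadic_squares)
    also have "\<dots> \<le> 16 / 3 * (2 ^ L / 2 / 2)\<^sup>2"
      by (simp add: power_divide square_power_two)
    also have "\<dots> \<le> 16 / 3 * y\<^sup>2" using True by (intro mult_left_mono power_mono) auto
    finally show ?thesis .
  next
    case False
    with Suc show ?thesis by simp
  qed
qed simp

text \<open>The second moment 1 forces the weighted level measures to sum to at least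
  \<open>3 / 16\<close>. Half of this is \<open>3 / 32\<close>, the errors take at most
  \<open>3 / 64\<close>, and the constant of \<open>dyadic_lower\<close> turns the remaining
  \<open>3 / 64\<close> into \<open>9 / 1024\<close>.\<close>

lemma lower_bound_from_levels:
  fixes F :: "'a \<Rightarrow> complex" and s :: real and m L :: nat
  assumes M: "prob_space M" and t: "\<And>l. l < m \<Longrightarrow> t l \<in> space M"
    and F[measurable]: "F \<in> borel_measurable M" and s: "s > 0"
    and Fb: "\<And>u. u \<in> space M \<Longrightarrow> cmod (F u) < 2 ^ L / 2"
    and F2: "(\<integral>u. (cmod (F u))\<^sup>2 \<partial>M) = 1"
    and L: "4 ^ L \<le> 144 * s"
    and lev: "\<And>i. i < L \<Longrightarrow>
      m * ((\<integral>u. exceeds F (2 ^ i / 2) u \<partial>M) / 2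
            - (1 / (768 * s) + 1 / (64 * L * (2 ^ i / 2)\<^sup>2)) - 1 / (768 * s))
        \<le> (\<Sum>l<m. exceeds F (2 ^ i / 2 / 2) (t l))"
  shows "9 / 1024 * m \<le> (\<Sum>l<m. (cmod (F (t l)))\<^sup>2)"
proof -
  interpret prob_space M by fact
  note int = integrable_exceeds[OF M F]
  let ?a = "\<lambda>i. 2 ^ i / 2 :: real"
  define q where "q = (\<lambda>i. \<integral>u. exceeds F (?a i) u \<partial>M)"
  have "(\<integral>u. (cmod (F u))\<^sup>2 \<partial>M) \<le> (\<integral>u. 1 / 4 + 4 * (\<Sum>i<L. (?a i)\<^sup>2 * exceeds F (?a i) u) \<partial>M)"
  proof (intro integral_mono)
    show "integrable M (\<lambda>u. (cmod (F u))\<^sup>2)"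
      using Fb by (intro integrable_const_bound[where B="(2 ^ L / 2)\<^sup>2"])
        (auto intro!: AE_I2 power_mono less_imp_le)
    show "integrable M (\<lambda>u. 1 / 4 + 4 * (\<Sum>i<L. (?a i)\<^sup>2 * exceeds F (?a i) u))"
      using int by (auto intro!: Bochner_Integration.integrable_add Bochner_Integration.integrable_sum)
    fix u assume "u \<in> space M"
    then show "(cmod (F u))\<^sup>2 \<le> 1 / 4 + 4 * (\<Sum>i<L. (?a i)\<^sup>2 * exceeds F (?a i) u)"
      unfolding exceeds_def using Fb by (intro dyadic_upper) auto
  qed
  also have "\<dots> = 1 / 4 + 4 * (\<Sum>i<L. (?a i)\<^sup>2 * q i)"
    using int by (simp add: prob_space q_def)
  finally have q: "3 / 16 \<le> (\<Sum>i<L. (?a i)\<^sup>2 * q i)" using F2 by simp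
  \<comment> \<open>The two terms \<open>1 / (768 * s)\<close> are merged. They cost at most
    \<open>1 / 32\<close> because the squared levels sum to at most \<open>12 * s\<close>; the other
    term costs \<open>1 / (64 * L)\<close> per level.\<close>
  have "(\<Sum>i<L. (?a i)\<^sup>2 * (1 / (384 * s) + 1 / (64 * L * (?a i)\<^sup>2)))
      = (\<Sum>i<L. (?a i)\<^sup>2) / (384 * s) + (\<Sum>i<L. 1 / (64 * real L))"
    by (simp add: algebra_simps sum.distrib sum_divide_distrib)
  also have "\<dots> \<le> 12 * s / (384 * s) + 1 / 64"
    using L s unfolding sum_dyadic_squares by (intro add_mono divide_right_mono) auto
  also have "\<dots> = 3 / 64" using s by simp
  finally have err: "(\<Sum>i<L. (?a i)\<^sup>2 * (1 / (384 * s) + 1 / (64 * L * (?a i)\<^sup>2))) \<le> 3 / 64" .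
  have "m * (3 / 64) \<le> m * ((\<Sum>i<L. (?a i)\<^sup>2 * q i) / 2
      - (\<Sum>i<L. (?a i)\<^sup>2 * (1 / (384 * s) + 1 / (64 * L * (?a i)\<^sup>2))))"
    using q err by (intro mult_left_mono) auto
  also have "\<dots> = (\<Sum>i<L. (?a i)\<^sup>2 * (m * (q i / 2 - (1 / (384 * s) + 1 / (64 * L * (?a i)\<^sup>2)))))"
    by (simp add: sum_divide_distrib sum_subtractf[symmetric] sum_distrib_left algebra_simps
        del: power_divide)
  also have "\<dots> \<le> (\<Sum>i<L. (?a i)\<^sup>2 * (\<Sum>l<m. exceeds F (?a i / 2) (t l)))"
  proof (intro sum_mono mult_left_mono)
    fix i assume "i \<in> {..<L}"
    then have "m * (q i / 2 - (1 / (768 * s) + 1 / (64 * L * (?a i)\<^sup>2)) - 1 / (768 * s))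
        \<le> (\<Sum>l<m. exceeds F (?a i / 2) (t l))"
      unfolding q_def by (intro lev) auto
    moreover have "1 / (384 * s) = 1 / (768 * s) + 1 / (768 * s)" by simp
    ultimately show "m * (q i / 2 - (1 / (384 * s) + 1 / (64 * L * (?a i)\<^sup>2)))
        \<le> (\<Sum>l<m. exceeds F (?a i / 2) (t l))" by (simp add: algebra_simps)
  qed auto
  also have "\<dots> = (\<Sum>l<m. \<Sum>i<L. (?a i)\<^sup>2 * exceeds F (?a i / 2) (t l))"
    unfolding sum_distrib_left by (rule sum.swap)
  also have "\<dots> \<le> (\<Sum>l<m. 16 / 3 * (cmod (F (t l)))\<^sup>2)"
    unfolding exceeds_def by (intro sum_mono dyadic_lower) auto
  also have "\<dots> = 16 / 3 * (\<Sum>l<m. (cmod (F (t l)))\<^sup>2)" by (simp add: sum_distrib_left)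
  finally show ?thesis by simp
qed

section \<open>Lower isometry on the cone\<close>

definition atom :: "('i \<Rightarrow> real) \<Rightarrow> ('i \<Rightarrow> 'a \<Rightarrow> complex) \<Rightarrow> 'i \<times> complex \<Rightarrow> 'a \<Rightarrow> complex" where
  "atom w \<psi> b u = snd b * \<psi> (fst b) u / of_real (w (fst b))"

lemma sum_phases: "(\<Sum>c\<in>{0, 1, -1, \<i>, -\<i>}. h c) = h 0 + h 1 + h (-1) + h \<i> + h (-\<i>)"
  by (simp add: complex_eq_iff add.assoc)

text \<open>Positive and negative parts of real and imaginary parts of \<open>x j\<close> become
  masses on the four unit phases. The factor 2 covers
  \<open>\<bar>Re z\<bar> + \<bar>Im z\<bar> \<le> 2 * cmod z\<close>. The masses depend neither on
  \<open>\<psi>\<close> nor on the point \<open>u\<close>.\<close>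

lemma atom_representation:
  fixes w :: "'i \<Rightarrow> real" and x :: "'i \<Rightarrow> complex"
  assumes I: "finite I" "I \<noteq> {}" and w: "\<And>j. j \<in> I \<Longrightarrow> 0 < w j" and R: "0 < R"
    and x: "2 * (\<Sum>j\<in>I. w j * cmod (x j)) \<le> R"
  shows "\<exists>p. (\<forall>b\<in>I \<times> {0, 1, -1, \<i>, -\<i>}. 0 \<le> p b) \<and> sum p (I \<times> {0, 1, -1, \<i>, -\<i>}) = 1 \<and>
    (\<forall>\<psi> u. (\<Sum>j\<in>I. x j * \<psi> j u)
      = of_real R * (\<Sum>b\<in>I \<times> {0, 1, -1, \<i>, -\<i>}. of_real (p b) * atom w \<psi> b u))"
proof -
  define T where "T = (\<Sum>j\<in>I. w j * (\<bar>Re (x j)\<bar> + \<bar>Im (x j)\<bar>) / R)"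
  \<comment> \<open>The phase 0 yields the zero atom and takes the leftover mass
    \<open>1 - T\<close>, spread evenly over \<open>I\<close>.\<close>
  define p where "p = (\<lambda>(j, c). if c = 0 then (1 - T) / card I else w j * max 0 (Re (x j * cnj c)) / R)"
  have "T \<le> (\<Sum>j\<in>I. w j * (2 * cmod (x j)) / R)"
    unfolding T_def
  proof (intro sum_mono divide_right_mono mult_left_mono)
    fix j show "\<bar>Re (x j)\<bar> + \<bar>Im (x j)\<bar> \<le> 2 * cmod (x j)"
      using abs_Re_le_cmod[of "x j"] abs_Im_le_cmod[of "x j"] by linarith
  qed (use w R in \<open>auto simp: less_imp_le\<close>)
  also have "\<dots> = 2 * (\<Sum>j\<in>I. w j * cmod (x j)) / R"
    by (simp add: sum_distrib_left sum_divide_distrib algebra_simps)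
  also have "\<dots> \<le> 1" using x R by simp
  finally have T: "T \<le> 1" .
  have p: "p (j, 0) = (1 - T) / card I" "p (j, 1) = w j * max 0 (Re (x j)) / R"
    "p (j, -1) = w j * max 0 (- Re (x j)) / R" "p (j, \<i>) = w j * max 0 (Im (x j)) / R"
    "p (j, -\<i>) = w j * max 0 (- Im (x j)) / R" for j
    by (simp_all add: p_def)
  have "sum p (I \<times> {0, 1, -1, \<i>, -\<i>}) = (\<Sum>j\<in>I. \<Sum>c\<in>{0, 1, -1, \<i>, -\<i>}. p (j, c))"
    unfolding sum.cartesian_product by simp
  also have "\<dots> = (\<Sum>j\<in>I. (1 - T) / card I + w j * (\<bar>Re (x j)\<bar> + \<bar>Im (x j)\<bar>) / R)"
    unfolding sum_phases p
    by (intro sum.cong refl) (auto simp: algebra_simps add_divide_distrib diff_divide_distrib abs_if max_def)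
  also have "\<dots> = 1" using I by (simp add: sum.distrib T_def[symmetric])
  finally have sum: "sum p (I \<times> {0, 1, -1, \<i>, -\<i>}) = 1" .
  have nonneg: "0 \<le> p b" if "b \<in> I \<times> {0, 1, -1, \<i>, -\<i>}" for b
    using that T R w by (auto simp: p_def less_imp_le)
  have rep: "(\<Sum>j\<in>I. x j * \<psi> j u)
      = of_real R * (\<Sum>b\<in>I \<times> {0, 1, -1, \<i>, -\<i>}. of_real (p b) * atom w \<psi> b u)" for \<psi> and u :: 'b
  proof -
    have "of_real R * (\<Sum>b\<in>I \<times> {0, 1, -1, \<i>, -\<i>}. of_real (p b) * atom w \<psi> b u)
        = (\<Sum>j\<in>I. \<Sum>c\<in>{0, 1, -1, \<i>, -\<i>}. of_real R * (of_real (p (j, c)) * atom w \<psi> (j, c) u))"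
      unfolding sum.cartesian_product sum_distrib_left by (simp only: case_prod_unfold prod.collapse)
    also have "\<dots> = (\<Sum>j\<in>I. x j * \<psi> j u)"
    proof (intro sum.cong refl)
      fix j assume j: "j \<in> I"
      have z: "x j = of_real (max 0 (Re (x j))) - of_real (max 0 (- Re (x j)))
          + \<i> * of_real (max 0 (Im (x j))) - \<i> * of_real (max 0 (- Im (x j)))"
        by (auto simp: complex_eq_iff max_def)
      have "(\<Sum>c\<in>{0, 1, -1, \<i>, -\<i>}. of_real R * (of_real (p (j, c)) * atom w \<psi> (j, c) u))
        = (of_real (max 0 (Re (x j))) - of_real (max 0 (- Re (x j)))
          + \<i> * of_real (max 0 (Im (x j))) - \<i> * of_real (max 0 (- Im (x j)))) * \<psi> j u"
        unfolding sum_phases p atom_def using R w[OF j] by (simp add: field_simps)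
      then show "(\<Sum>c\<in>{0, 1, -1, \<i>, -\<i>}. of_real R * (of_real (p (j, c)) * atom w \<psi> (j, c) u)) = x j * \<psi> j u"
        by (simp only: z[symmetric])
    qed
    finally show ?thesis by simp
  qed
  show ?thesis using sum nonneg rep by (intro exI[of _ p]) blast
qed

section \<open>Number of levels, Parseval's identity and the cost of the union bound\<close>

lemma exists_power_four:
  fixes y :: real
  assumes "1 \<le> y"
  shows "\<exists>L. y < 4 ^ L \<and> 4 ^ L \<le> 4 * y"
proof -
  obtain n where n: "y < 4 ^ n" using real_arch_pow[of 4 y] by auto
  define L where "L = (LEAST n. y < 4 ^ n)"
  have L: "y < 4 ^ L" unfolding L_def using n by (rule LeastI)
  then obtain K where K: "L = Suc K" using assms by (cases L) auto
  then have "\<not> y < 4 ^ K" using not_less_Least[of K "\<lambda>n. y < 4 ^ n"] by (simp add: L_def)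
  then have "4 ^ L \<le> 4 * y" using K by simp
  with L show ?thesis by blast
qed

lemma parseval_finite:
  fixes \<psi> :: "'i \<Rightarrow> 'a \<Rightarrow> complex"
  assumes M: "prob_space M" and I: "finite I"
    and m[measurable]: "\<And>j. j \<in> I \<Longrightarrow> \<psi> j \<in> borel_measurable M"
    and w: "\<And>j u. j \<in> I \<Longrightarrow> u \<in> space M \<Longrightarrow> cmod (\<psi> j u) \<le> w j"
    and orth: "\<And>j k. j \<in> I \<Longrightarrow> k \<in> I \<Longrightarrow> (\<integral>u. \<psi> j u * cnj (\<psi> k u) \<partial>M) = (if j = k then 1 else 0)"
  shows "(\<integral>u. (cmod (\<Sum>j\<in>I. x j * \<psi> j u))\<^sup>2 \<partial>M) = (\<Sum>j\<in>I. (cmod (x j))\<^sup>2)"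
proof -
  interpret prob_space M by fact
  have [measurable]: "cnj \<in> borel_measurable borel"
    by (intro borel_measurable_continuous_onI continuous_intros)
  have int: "integrable M (\<lambda>u. \<psi> j u * cnj (\<psi> k u))" if jk: "j \<in> I" "k \<in> I" for j k
  proof (rule integrable_const_bound[where B="w j * w k"])
    show "AE u in M. norm (\<psi> j u * cnj (\<psi> k u)) \<le> w j * w k"
      using jk w by (intro AE_I2) (auto simp: norm_mult intro!: mult_mono order_trans[OF norm_ge_zero w[OF jk(1)]])
    show "(\<lambda>u. \<psi> j u * cnj (\<psi> k u)) \<in> borel_measurable M"
      using jk by measurable
  qed
  have "complex_of_real (\<integral>u. (cmod (\<Sum>j\<in>I. x j * \<psi> j u))\<^sup>2 \<partial>M)
      = (\<integral>u. complex_of_real ((cmod (\<Sum>j\<in>I. x j * \<psi> j u))\<^sup>2) \<partial>M)"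
    by (rule integral_complex_of_real[symmetric])
  also have "\<dots> = (\<integral>u. (\<Sum>j\<in>I. \<Sum>k\<in>I. x j * cnj (x k) * (\<psi> j u * cnj (\<psi> k u))) \<partial>M)"
    unfolding complex_norm_square
    by (intro Bochner_Integration.integral_cong refl)
       (simp add: sum_product algebra_simps)
  also have "\<dots> = (\<Sum>j\<in>I. \<Sum>k\<in>I. x j * cnj (x k) * (\<integral>u. \<psi> j u * cnj (\<psi> k u) \<partial>M))"
    using int by simp
  also have "\<dots> = (\<Sum>j\<in>I. \<Sum>k\<in>I. if j = k then x j * cnj (x k) else 0)"
    by (intro sum.cong refl) (simp add: orth)
  also have "\<dots> = (\<Sum>j\<in>I. x j * cnj (x j))" using I by simp
  also have "\<dots> = complex_of_real (\<Sum>j\<in>I. (cmod (x j))\<^sup>2)"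
    by (simp only: of_real_sum complex_norm_square)
  finally show ?thesis using of_real_eq_iff by blast
qed

text \<open>The logarithm of the class size, \<open>k * ln (5 * N)\<close>, is at most
  \<open>m / (64 * L * a2)\<close>, and \<open>ln (2 * L / \<gamma>)\<close> is at most
  \<open>m / (768 * s)\<close>. The number of levels \<open>L\<close> is itself of order
  \<open>ln s\<close>.\<close>

lemma union_bound_term:
  fixes s \<gamma> a2 :: real and m k L N :: nat
  assumes s: "4 \<le> s" and N: "2 \<le> N" and \<gamma>: "0 < \<gamma>" "\<gamma> < 1" and L: "1 \<le> L" "4 ^ L \<le> 144 * s"
    and a2: "0 < a2" and k: "k \<le> 18432 * (s / a2) * ln (6144 * s)"
    and m: "10 ^ 9 * s * max ((ln s) ^ 3 * ln N) (ln (1 / \<gamma>)) \<le> m"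
  shows "(5 * real N) ^ k * exp (- (m * (1 / (768 * s) + 1 / (64 * L * a2)))) \<le> \<gamma> / (2 * L)"
proof -
  define A where "A = ln s"
  define B where "B = ln (real N)"
  define G where "G = ln (1 / \<gamma>)"
  have ln2: "1 / 2 \<le> ln (2 :: real)" "ln (2 :: real) \<le> 1" using ln2_ge_two_thirds ln_2_less_1 by auto
  have A: "1 \<le> A" unfolding A_def using s exp_le by (subst ln_ge_iff) auto
  have B2: "ln 2 \<le> B" unfolding B_def using N by (subst ln_le_cancel_iff) auto
  then have B: "1 / 2 \<le> B" using ln2 by simp
  have G: "0 \<le> G" using \<gamma> by (simp add: G_def)
  have "ln (6144 :: real) \<le> ln (2 ^ 13)" by (subst ln_le_cancel_iff) auto
  also have "\<dots> = 13 * ln 2" by (subst ln_realpow) auto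
  finally have "ln (6144 * s) \<le> 13 + A" using ln2 s by (simp add: ln_mult A_def)
  then have l1: "ln (6144 * s) \<le> 14 * A" using A by simp
  have "ln (5 :: real) \<le> ln (2 ^ 3)" by (subst ln_le_cancel_iff) auto
  also have "\<dots> = 3 * ln 2" by (subst ln_realpow) auto
  finally have "ln (5 :: real) \<le> 3 * B" using B2 by linarith
  moreover have "ln (5 * real N) = ln 5 + B" using N by (simp add: ln_mult B_def)
  ultimately have l2: "ln (5 * real N) \<le> 4 * B" by linarith
  have "real L * 1 \<le> real L * ln 4"
    using exp_le by (intro mult_left_mono) (auto simp: ln_ge_iff)
  also have "\<dots> = ln (4 ^ L)" by (subst ln_realpow) auto
  also have "\<dots> \<le> ln (144 * s)" using L s by (subst ln_le_cancel_iff) auto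
  also have "\<dots> = ln 144 + A" using s by (simp add: ln_mult A_def)
  also have "ln (144 :: real) \<le> ln (2 ^ 8)" by (subst ln_le_cancel_iff) auto
  also have "ln (2 ^ 8 :: real) = 8 * ln 2" by (subst ln_realpow) auto
  finally have LA: "L \<le> 9 * A" using A ln2 by simp
  define Q where "Q = s / a2"
  have Q: "0 < Q" using s a2 by (simp add: Q_def)
  \<comment> \<open>The factors 14 and 4 are the constants of \<open>l1\<close> and
    \<open>l2\<close>; the product \<open>18432 * 14 * 4\<close> is 1032192.\<close>
  have "k * ln (5 * real N) \<le> (18432 * Q * (14 * A)) * (4 * B)"
    using k l1 l2 Q A B N unfolding Q_def[symmetric]
    by (intro mult_mono order_trans[OF k[folded Q_def]] mult_left_mono) auto
  then have c1: "k * ln (5 * real N) \<le> 1032192 * (Q * A * B)" by simp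
  have m1: "10 ^ 9 * s * (A ^ 3 * B) \<le> m" and m2: "10 ^ 9 * s * G \<le> m"
    using m s by (auto simp: A_def B_def G_def intro: order_trans[rotated])
  have "1032192 * (Q * A * B) \<le> (10 ^ 9 / 576) * (Q * A * B) * A"
    using Q A B mult_mono[of "1032192 * (Q * A * B)" "(10 ^ 9 / 576) * (Q * A * B)" 1 A] by simp
  also have "\<dots> = 10 ^ 9 * s * (A ^ 3 * B) / (64 * (9 * A) * a2)"
    using A a2 by (simp add: Q_def field_simps power3_eq_cube)
  also have "\<dots> \<le> m / (64 * L * a2)"
    using LA L m1 A B s a2 by (intro frac_le mult_mono) auto
  finally have c2: "1032192 * (Q * A * B) \<le> m / (64 * L * a2)" .
  have "1 * A \<le> A ^ 2 * A" using A by (intro mult_right_mono) (auto simp: one_le_power)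
  then have "A * (1 / 2) \<le> A ^ 3 * B" using A B by (intro mult_mono) (auto simp: power3_eq_cube power2_eq_square)
  moreover have "ln (2 * real L) \<le> 2 * real L" using ln_le_minus_one[of "2 * real L"] L by simp
  ultimately have l3: "ln (2 * real L) \<le> 36 * (A ^ 3 * B)" using LA by simp
  \<comment> \<open>Both sample bounds \<open>m1\<close> and \<open>m2\<close> are used, so each
    summand gets half of \<open>m / (768 * s)\<close>, whence \<open>1536 = 2 * 768\<close>.\<close>
  have "ln (2 * real L) + G \<le> 10 ^ 9 * (A ^ 3 * B) / 1536 + 10 ^ 9 * G / 1536"
    using l3 G A B by (intro add_mono order_trans[OF l3]) auto
  also have "\<dots> = (10 ^ 9 * s * (A ^ 3 * B) + 10 ^ 9 * s * G) / (1536 * s)"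
    using s by (simp add: field_simps)
  also have "\<dots> \<le> (m + m) / (1536 * s)" using m1 m2 s by (intro divide_right_mono) auto
  also have "\<dots> = m / (768 * s)" by simp
  finally have c3: "ln (2 * real L) + G \<le> m / (768 * s)" .
  have "(5 * real N) ^ k * exp (- (m * (1 / (768 * s) + 1 / (64 * L * a2))))
      = exp (k * ln (5 * real N) - m / (768 * s) - m / (64 * L * a2))"
    using N by (simp add: exp_diff exp_minus exp_add exp_of_nat_mult field_simps)
  also have "\<dots> \<le> exp (- (ln (2 * real L) + G))" using c1 c2 c3 by simp
  also have "\<dots> = \<gamma> / (2 * L)" using \<gamma> L by (simp add: G_def exp_minus exp_add ln_div exp_diff field_simps)
  finally show ?thesis .
qed

lemma iid_sum_le_sets:
  fixes X :: "'a \<Rightarrow> real"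
  assumes [measurable]: "X \<in> borel_measurable M"
  shows "{t \<in> space (Pi\<^sub>M {..<m::nat} (\<lambda>_. M)). (\<Sum>l<m. X (t l)) \<le> c} \<in> sets (Pi\<^sub>M {..<m} (\<lambda>_. M))"
  by measurable

text \<open>In the dyadic level \<open>i\<close> the class of averages has \<open>(5 N) ^ k i\<close> members with \<open>k i\<close> of order
  \<open>s log s / (a i)\<^sup>2\<close>, and one member fails with probability at most \<open>exp (- m \<theta> i)\<close>. The first
  summand of \<open>\<theta> i\<close> pays for \<open>\<gamma>\<close> and for the number of levels, the second for the size of the class;
  the weighted sum of \<open>(a i)\<^sup>2 \<theta> i\<close> stays bounded by a small absolute constant.\<close>

lemma lower_isometry_normalized:
  fixes \<psi> :: "'i \<Rightarrow> 'a \<Rightarrow> complex" and w :: "'i \<Rightarrow> real" and m :: nat and s \<gamma> :: real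
  assumes M: "prob_space M" and I: "finite I" "2 \<le> card I"
    and mes[measurable]: "\<And>j. j \<in> I \<Longrightarrow> \<psi> j \<in> borel_measurable M"
    and w: "\<And>j u. j \<in> I \<Longrightarrow> u \<in> space M \<Longrightarrow> cmod (\<psi> j u) \<le> w j" and w0: "\<And>j. j \<in> I \<Longrightarrow> 0 < w j"
    and orth: "\<And>j k. j \<in> I \<Longrightarrow> k \<in> I \<Longrightarrow> (\<integral>u. \<psi> j u * cnj (\<psi> k u) \<partial>M) = (if j = k then 1 else 0)"
    and s: "4 \<le> s" and \<gamma>: "0 < \<gamma>" "\<gamma> < 1" and m0: "0 < m"
    and m: "10 ^ 9 * s * max ((ln s) ^ 3 * ln (card I)) (ln (1 / \<gamma>)) \<le> m"
  shows "\<exists>E\<in>sets (Pi\<^sub>M {..<m} (\<lambda>_. M)). 1 - \<gamma> < measure (Pi\<^sub>M {..<m} (\<lambda>_. M)) E \<and>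
    (\<forall>t\<in>E. \<forall>x. (\<Sum>j\<in>I. (cmod (x j))\<^sup>2) = 1 \<longrightarrow> (\<Sum>j\<in>I. w j * cmod (x j)) \<le> 3 * sqrt s \<longrightarrow>
      9 / 1024 * m \<le> (\<Sum>l<m. (cmod (\<Sum>j\<in>I. x j * \<psi> j (t l)))\<^sup>2))"
proof -
  let ?P = "Pi\<^sub>M {..<m} (\<lambda>_. M)"
  interpret M: prob_space M by fact
  interpret P: prob_space ?P by (intro prob_space_PiM M)
  \<comment> \<open>The lower bound places \<open>2 ^ L / 2\<close> above \<open>3 * sqrt s\<close>,
    which bounds \<open>F\<close>; the upper bound limits the sum of the squared levels.\<close>
  obtain L where L: "36 * s < 4 ^ L" "4 ^ L \<le> 144 * s"
    using exists_power_four[of "36 * s"] s by auto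
  have L1: "1 \<le> L" using L s by (cases L) auto
  \<comment> \<open>Twice the cone bound \<open>3 * sqrt s\<close>, as
    \<open>atom_representation\<close> demands.\<close>
  define R where "R = 6 * sqrt s"
  have R: "0 < R" "R\<^sup>2 = 36 * s" using s by (auto simp: R_def power_mult_distrib)
  define a where "a = (\<lambda>i::nat. 2 ^ i / 2 :: real)"
  define \<theta> where "\<theta> = (\<lambda>i. 1 / (768 * s) + 1 / (64 * L * (a i)\<^sup>2))"
  \<comment> \<open>Since \<open>9216 * s = 256 * R\<^sup>2\<close> and
    \<open>6144 = 8 * 768\<close>, this length brings the Maurey error down to
    \<open>1 / (768 * s)\<close>.\<close>
  define k where "k = (\<lambda>i. nat \<lceil>9216 * (s / (a i)\<^sup>2) * ln (6144 * s)\<rceil>)"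
  define B where "B = I \<times> {0, 1, -1, \<i>, -\<i>}"
  define h where "h = (\<lambda>i bs u. of_real (R / k i) * atom_sum (atom w \<psi>) bs u)"
  define H where "H = (\<lambda>i. {bs. set bs \<subseteq> B \<and> length bs = k i})"
  define Bad where "Bad = (\<lambda>i bs. {t \<in> space ?P. (\<Sum>l<m. exceeds (h i bs) (3 * a i / 4) (t l))
    \<le> m * (\<integral>u. exceeds (h i bs) (3 * a i / 4) u \<partial>M) / 2 - m * \<theta> i})"
  have aL: "0 < a i" "(a i)\<^sup>2 \<le> 9 * s" if "i < L" for i
  proof -
    have "(4::real) ^ i \<le> 4 ^ (L - 1)" using that by (intro power_increasing) auto
    moreover have "4 * (4::real) ^ (L - 1) = 4 ^ L" using L1 by (cases L) auto
    moreover have "(a i)\<^sup>2 = 4 ^ i / 4" by (simp add: a_def power_divide square_power_two)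
    ultimately show "(a i)\<^sup>2 \<le> 9 * s" using L by linarith
  qed (simp add: a_def)
  have a0: "a i \<noteq> 0" for i by (simp add: a_def)
  have ln1: "1 \<le> ln (6144 * s)" using s exp_le by (subst ln_ge_iff) auto
  have k: "1 \<le> k i" "9216 * (s / (a i)\<^sup>2) * ln (6144 * s) \<le> k i"
     "k i \<le> 18432 * (s / (a i)\<^sup>2) * ln (6144 * s)" if i: "i < L" for i
  proof -
    let ?y = "9216 * (s / (a i)\<^sup>2) * ln (6144 * s)"
    have "1 \<le> 9216 * (s / (a i)\<^sup>2)" using aL[OF i] s by (simp add: field_simps)
    then have y: "1 * 1 \<le> ?y" using ln1 by (intro mult_mono) auto
    have ceil: "1 \<le> nat \<lceil>y\<rceil>" "y \<le> nat \<lceil>y\<rceil>" "nat \<lceil>y\<rceil> \<le> 2 * y" if "1 \<le> y" for y :: real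
      using that by linarith+
    show "1 \<le> k i" "?y \<le> k i" using ceil[of ?y] y unfolding k_def by simp_all
    have "k i \<le> 2 * ?y" using ceil[of ?y] y unfolding k_def by simp
    then show "k i \<le> 18432 * (s / (a i)\<^sup>2) * ln (6144 * s)" by simp
  qed
  have Bfin: "finite B" using I by (simp add: B_def)
  have cB: "card B = 5 * card I"
    by (simp add: B_def card_cartesian_product complex_eq_iff)
  have atm: "atom w \<psi> b \<in> borel_measurable M" if "b \<in> B" for b
  proof -
    have [measurable]: "\<psi> (fst b) \<in> borel_measurable M" using that by (intro mes) (auto simp: B_def)
    show ?thesis unfolding atom_def[abs_def] by measurable
  qed
  have at1: "cmod (atom w \<psi> b u) \<le> 1" if b: "b \<in> B" and u: "u \<in> space M" for b u
  proof -
    have j: "fst b \<in> I" "cmod (snd b) \<le> 1" using b by (auto simp: B_def)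
    have "cmod (atom w \<psi> b u) = cmod (snd b) * (cmod (\<psi> (fst b) u) / w (fst b))"
      using w0[OF j(1)] by (simp add: atom_def norm_mult norm_divide)
    also have "\<dots> \<le> 1 * 1" using j w[OF j(1) u] w0[OF j(1)] by (intro mult_mono) auto
    finally show ?thesis by simp
  qed
  have hm: "h i bs \<in> borel_measurable M" if "set bs \<subseteq> B" for i bs
  proof -
    have [measurable]: "atom_sum (atom w \<psi>) bs \<in> borel_measurable M"
      using that atm by (intro atom_sum_measurable) auto
    show ?thesis unfolding h_def by measurable
  qed
  have Hfin: "finite (H i)" for i unfolding H_def by (intro finite_lists_length_eq Bfin)
  have cH: "card (H i) = (5 * card I) ^ k i" for i
    unfolding H_def by (simp add: card_lists_length_eq[OF Bfin] cB)
  have Bads: "Bad i bs \<in> sets ?P" if "bs \<in> H i" for i bs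
    unfolding Bad_def using that by (intro iid_sum_le_sets exceeds_measurable hm) (auto simp: H_def)
  have Badp: "measure ?P (Bad i bs) \<le> exp (- (m * \<theta> i))" if "bs \<in> H i" for i bs
    unfolding Bad_def
  proof (rule iid_lower_tail[OF M])
    show "exceeds (h i bs) (3 * a i / 4) \<in> borel_measurable M"
      using that by (intro exceeds_measurable hm) (auto simp: H_def)
  qed (auto simp: exceeds_def)
  define U where "U = (\<Union>i<L. \<Union>bs\<in>H i. Bad i bs)"
  have Us: "U \<in> sets ?P" unfolding U_def using Hfin Bads by (intro sets.finite_UN) auto
  have "measure ?P U \<le> (\<Sum>i<L. measure ?P (\<Union>bs\<in>H i. Bad i bs))"
    unfolding U_def using Hfin Bads
    by (intro P.finite_measure_subadditive_finite) (auto intro!: sets.finite_UN)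
  also have "\<dots> \<le> (\<Sum>i<L. \<Sum>bs\<in>H i. measure ?P (Bad i bs))"
    using Hfin Bads by (intro sum_mono P.finite_measure_subadditive_finite) auto
  also have "\<dots> \<le> (\<Sum>i<L. \<Sum>bs\<in>H i. exp (- (m * \<theta> i)))"
    by (intro sum_mono Badp)
  also have "\<dots> = (\<Sum>i<L. (5 * real (card I)) ^ k i * exp (- (m * \<theta> i)))"
    by (simp add: cH)
  \<comment> \<open>Every level receives an equal share of \<open>\<gamma> / 2\<close>; the other
    half makes the final inequality strict.\<close>
  also have "\<dots> \<le> (\<Sum>i<L. \<gamma> / (2 * L))"
    unfolding \<theta>_def using a0 k I s \<gamma> L L1 m by (intro sum_mono union_bound_term) auto
  also have "\<dots> = \<gamma> / 2" using L1 by simp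
  finally have Up: "measure ?P U < \<gamma>" using \<gamma> by simp
  show ?thesis
  proof (intro bexI[of _ "space ?P - U"] conjI ballI allI impI)
    show "1 - \<gamma> < measure ?P (space ?P - U)" using P.prob_compl[OF Us] Up by simp
    show "space ?P - U \<in> sets ?P" using Us by auto
    fix t x assume tE: "t \<in> space ?P - U" and x2: "(\<Sum>j\<in>I. (cmod (x j))\<^sup>2) = 1"
      and x1: "(\<Sum>j\<in>I. w j * cmod (x j)) \<le> 3 * sqrt s"
    have t: "t l \<in> space M" if "l < m" for l using tE that by (auto simp: space_PiM PiE_def)
    define F where "F = (\<lambda>u. \<Sum>j\<in>I. x j * \<psi> j u)"
    have [measurable]: "F \<in> borel_measurable M" unfolding F_def by measurable
    have "\<exists>p. (\<forall>b\<in>B. 0 \<le> p b) \<and> sum p B = 1 \<and> (\<forall>(\<phi> :: 'i \<Rightarrow> 'a \<Rightarrow> complex) u.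
        (\<Sum>j\<in>I. x j * \<phi> j u) = of_real R * (\<Sum>b\<in>B. of_real (p b) * atom w \<phi> b u))"
      unfolding B_def by (rule atom_representation) (use I w0 R x1 in \<open>auto simp: R_def\<close>)
    then obtain p where p: "\<forall>b\<in>B. 0 \<le> p b" "sum p B = 1"
      and rep: "\<forall>(\<phi> :: 'i \<Rightarrow> 'a \<Rightarrow> complex) u.
        (\<Sum>j\<in>I. x j * \<phi> j u) = of_real R * (\<Sum>b\<in>B. of_real (p b) * atom w \<phi> b u)"
      by (elim exE conjE)
    have rep: "F u = of_real R * (\<Sum>b\<in>B. of_real (p b) * atom w \<psi> b u)" for u
      unfolding F_def using rep by (elim allE)
    have p0: "0 \<le> p b" if "b \<in> B" for b using p that by blast
    have Fb: "cmod (F u) < 2 ^ L / 2" if u: "u \<in> space M" for u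
    proof -
      have "cmod (F u) \<le> (\<Sum>j\<in>I. w j * cmod (x j))"
        unfolding F_def using w[OF _ u]
        by (intro order_trans[OF norm_sum] sum_mono) (simp add: norm_mult mult.commute[of "w _"] mult_left_mono)
      moreover have "R < 2 ^ L"
        using L R by (intro power2_less_imp_less[of R]) (auto simp: square_power_two)
      ultimately show ?thesis using x1 by (simp add: R_def)
    qed
    have F2: "(\<integral>u. (cmod (F u))\<^sup>2 \<partial>M) = 1"
      unfolding F_def x2[symmetric] by (intro parseval_finite[OF M I(1) mes w orth])
    have "9 / 1024 * m \<le> (\<Sum>l<m. (cmod (F (t l)))\<^sup>2)"
    proof (rule lower_bound_from_levels[OF M t _ _ Fb F2 L(2)])
      fix i assume i: "i < L"
      have "a i \<le> 8 * R"
      proof (rule power2_le_imp_le)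
        show "(a i)\<^sup>2 \<le> (8 * R)\<^sup>2" using aL[OF i] s R by (simp add: power_mult_distrib)
      qed (use R in auto)
      moreover have "8 * exp (- (k i * (a i)\<^sup>2 / (256 * R\<^sup>2))) \<le> 1 / (768 * s)"
      proof -
        have "ln (6144 * s) \<le> k i * (a i)\<^sup>2 / (256 * R\<^sup>2)"
          using k(2)[OF i] aL[OF i] s R by (simp add: field_simps)
        then have "exp (- (k i * (a i)\<^sup>2 / (256 * R\<^sup>2))) \<le> exp (- ln (6144 * s))" by simp
        also have "\<dots> = 1 / (6144 * s)" using s by (simp add: exp_minus field_simps)
        finally show ?thesis by simp
      qed
      ultimately have "\<exists>bs. set bs \<subseteq> B \<and> length bs = k i \<and>
          mixed_mean M m t (exceeds (\<lambda>u. of_real (R / k i) * atom_sum (atom w \<psi>) bs u - F u) (a i / 4)) \<le> 1 / (768 * s)"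
        using k(1)[OF i] aL[OF i]
        by (intro maurey_approximation[where p=p] M t m0 Bfin p0 p atm at1 rep) auto
      then obtain bs where bs: "bs \<in> H i"
        and mm: "mixed_mean M m t (exceeds (\<lambda>u. h i bs u - F u) (a i / 4)) \<le> 1 / (768 * s)"
        by (auto simp: H_def h_def)
      \<comment> \<open>The list \<open>bs\<close> was chosen in dependence on \<open>t\<close> and
        \<open>x\<close>. This is harmless because \<open>U\<close> contains the failure events of
        all lists in \<open>H i\<close>.\<close>
      have "t \<notin> Bad i bs" using tE i bs by (auto simp: U_def)
      then have "m * (\<integral>u. exceeds (h i bs) (3 * a i / 4) u \<partial>M) / 2 - m * \<theta> i
          < (\<Sum>l<m. exceeds (h i bs) (3 * a i / 4) (t l))"
        using tE by (auto simp: Bad_def)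
      from level_count_transfer[OF M t m0 _ _ mm this] bs
      have "m * ((\<integral>u. exceeds F (a i) u \<partial>M) / 2 - \<theta> i - 1 / (768 * s)) \<le> (\<Sum>l<m. exceeds F (a i / 2) (t l))"
        using hm by (auto simp: H_def)
      then show "m * ((\<integral>u. exceeds F (2 ^ i / 2) u \<partial>M) / 2
            - (1 / (768 * s) + 1 / (64 * L * (2 ^ i / 2)\<^sup>2)) - 1 / (768 * s))
        \<le> (\<Sum>l<m. exceeds F (2 ^ i / 2 / 2) (t l))"
        unfolding \<theta>_def a_def .
    qed (use s in auto)
    then show "9 / 1024 * m \<le> (\<Sum>l<m. (cmod (\<Sum>j\<in>I. x j * \<psi> j (t l)))\<^sup>2)" by (simp add: F_def)
  qed
qed

text \<open>Both sides of the isometry are homogeneous of degree 2 and the cone condition is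
  invariant under scaling, which removes the normalization. A one-element \<open>I\<close> has
  \<open>ln (card I) = 0\<close>, so it cannot use the union bound and is treated directly.\<close>

lemma lower_isometry_on_cone:
  fixes \<psi> :: "'i \<Rightarrow> 'a \<Rightarrow> complex" and w :: "'i \<Rightarrow> real" and m :: nat and s \<gamma> :: real
  assumes M: "prob_space M" and I: "finite I" "I \<noteq> {}"
    and mes[measurable]: "\<And>j. j \<in> I \<Longrightarrow> \<psi> j \<in> borel_measurable M"
    and w: "\<And>j u. j \<in> I \<Longrightarrow> u \<in> space M \<Longrightarrow> cmod (\<psi> j u) \<le> w j" and w0: "\<And>j. j \<in> I \<Longrightarrow> 0 < w j"
    and ws: "\<And>j. j \<in> I \<Longrightarrow> (w j)\<^sup>2 \<le> s"
    and orth: "\<And>j k. j \<in> I \<Longrightarrow> k \<in> I \<Longrightarrow> (\<integral>u. \<psi> j u * cnj (\<psi> k u) \<partial>M) = (if j = k then 1 else 0)"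
    and s: "4 \<le> s" and \<gamma>: "0 < \<gamma>" "\<gamma> < 1"
    and m: "10 ^ 9 * s * max ((ln s) ^ 3 * ln (card I)) (ln (1 / \<gamma>)) \<le> m"
  shows "\<exists>E\<in>sets (Pi\<^sub>M {..<m} (\<lambda>_. M)). 1 - \<gamma> < measure (Pi\<^sub>M {..<m} (\<lambda>_. M)) E \<and>
    (\<forall>t\<in>E. \<forall>x. (\<Sum>j\<in>I. w j * cmod (x j)) \<le> 3 * sqrt s * sqrt (\<Sum>j\<in>I. (cmod (x j))\<^sup>2) \<longrightarrow>
      9 / 1024 * m * (\<Sum>j\<in>I. (cmod (x j))\<^sup>2) \<le> (\<Sum>l<m. (cmod (\<Sum>j\<in>I. x j * \<psi> j (t l)))\<^sup>2))"
proof -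
  let ?P = "Pi\<^sub>M {..<m} (\<lambda>_. M)"
  interpret M: prob_space M by fact
  interpret P: prob_space ?P by (intro prob_space_PiM M)
  have G: "0 < ln (1 / \<gamma>)" using \<gamma> by simp
  have mG: "10 ^ 9 * s * ln (1 / \<gamma>) \<le> m"
    using m s by (auto intro: order_trans[rotated])
  have "0 < 10 ^ 9 * s * ln (1 / \<gamma>)" using G s by (intro mult_pos_pos) auto
  then have m0: "0 < m" using mG by linarith
  show ?thesis
  proof (cases "2 \<le> card I")
    case True
    obtain E where E: "E \<in> sets ?P" "1 - \<gamma> < measure ?P E"
      and iso: "\<And>t x. t \<in> E \<Longrightarrow> (\<Sum>j\<in>I. (cmod (x j))\<^sup>2) = 1 \<Longrightarrow> (\<Sum>j\<in>I. w j * cmod (x j)) \<le> 3 * sqrt s \<Longrightarrow>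
        9 / 1024 * m \<le> (\<Sum>l<m. (cmod (\<Sum>j\<in>I. x j * \<psi> j (t l)))\<^sup>2)"
      using lower_isometry_normalized[OF M I(1) True mes w w0 orth s \<gamma> m0 m] by blast
    show ?thesis
    proof (intro bexI[OF _ E(1)] conjI E(2) ballI allI impI)
      fix t x assume t: "t \<in> E"
        and cone: "(\<Sum>j\<in>I. w j * cmod (x j)) \<le> 3 * sqrt s * sqrt (\<Sum>j\<in>I. (cmod (x j))\<^sup>2)"
      define n where "n = sqrt (\<Sum>j\<in>I. (cmod (x j))\<^sup>2)"
      have n2: "n\<^sup>2 = (\<Sum>j\<in>I. (cmod (x j))\<^sup>2)" by (simp add: n_def sum_nonneg)
      show "9 / 1024 * m * (\<Sum>j\<in>I. (cmod (x j))\<^sup>2) \<le> (\<Sum>l<m. (cmod (\<Sum>j\<in>I. x j * \<psi> j (t l)))\<^sup>2)"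
      proof (cases "n = 0")
        case True
        then show ?thesis using n2 by (auto intro!: sum_nonneg)
      next
        case False
        then have n: "0 < n" by (simp add: n_def sum_nonneg less_le)
        have "9 / 1024 * m \<le> (\<Sum>l<m. (cmod (\<Sum>j\<in>I. (x j / n) * \<psi> j (t l)))\<^sup>2)"
        proof (rule iso[OF t])
          show "(\<Sum>j\<in>I. (cmod (x j / n))\<^sup>2) = 1"
            using n by (simp add: norm_divide power_divide sum_divide_distrib[symmetric] n2[symmetric])
          have "(\<Sum>j\<in>I. w j * cmod (x j / n)) = (\<Sum>j\<in>I. w j * cmod (x j)) / n"
            using n by (simp add: norm_divide sum_divide_distrib)
          also have "\<dots> \<le> 3 * sqrt s"
            using cone n by (simp add: n_def[symmetric] pos_divide_le_eq)
          finally show "(\<Sum>j\<in>I. w j * cmod (x j / n)) \<le> 3 * sqrt s" .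
        qed
        also have "\<dots> = (\<Sum>l<m. (cmod (\<Sum>j\<in>I. x j * \<psi> j (t l)))\<^sup>2) / n\<^sup>2"
          using n by (simp add: sum_divide_distrib[symmetric] norm_divide power_divide)
        finally show ?thesis using n by (simp add: n2[symmetric] field_simps)
      qed
    qed
  next
    case False
    moreover have "card I \<noteq> 0" using I by simp
    ultimately have "card I = 1" by linarith
    then obtain j where j: "I = {j}" by (auto simp: card_1_singleton_iff)
    \<comment> \<open>The bound \<open>(w j)\<^sup>2 \<le> s\<close> scales the squared modulus into
      \<open>[0, 1]\<close>, as the lower tail estimate needs.\<close>
    define X where "X = (\<lambda>u. (cmod (\<psi> j u))\<^sup>2 / s)"
    have [measurable]: "\<psi> j \<in> borel_measurable M" using mes j by simp
    have Xm[measurable]: "X \<in> borel_measurable M" unfolding X_def by measurable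
    have X01: "0 \<le> X u \<and> X u \<le> 1" if "u \<in> space M" for u
    proof -
      have "(cmod (\<psi> j u))\<^sup>2 \<le> (w j)\<^sup>2" using w j that by (intro power_mono) auto
      also have "\<dots> \<le> s" using ws j by simp
      finally show ?thesis using s by (simp add: X_def)
    qed
    have "(\<integral>u. (cmod (\<Sum>i\<in>I. 1 * \<psi> i u))\<^sup>2 \<partial>M) = (\<Sum>i\<in>I. (cmod 1)\<^sup>2)"
      by (intro parseval_finite[OF M I(1) mes w orth])
    then have EX: "(\<integral>u. X u \<partial>M) = 1 / s" by (simp add: X_def j)
    \<comment> \<open>The mean of \<open>X\<close> is \<open>1 / s\<close>, so the threshold is
      \<open>m / (2 * s) - m / (4 * s) = m / (4 * s)\<close>.\<close>
    let ?U = "{t \<in> space ?P. (\<Sum>l<m. X (t l)) \<le> m * (\<integral>u. X u \<partial>M) / 2 - m * (1 / (4 * s))}"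
    have Us: "?U \<in> sets ?P" by (rule iid_sum_le_sets[OF Xm])
    have "measure ?P ?U \<le> exp (- (m * (1 / (4 * s))))"
      by (rule iid_lower_tail[OF M Xm X01])
    also have "\<dots> < exp (- ln (1 / \<gamma>))"
    proof -
      have "ln (1 / \<gamma>) * 1 < ln (1 / \<gamma>) * (10 ^ 9 / 4)" using G by (intro mult_strict_left_mono) auto
      also have "\<dots> \<le> m * (1 / (4 * s))" using mG s by (simp add: field_simps)
      finally show ?thesis by simp
    qed
    also have "\<dots> = \<gamma>" using \<gamma> by (simp add: exp_minus ln_div)
    finally have Up: "measure ?P ?U < \<gamma>" .
    show ?thesis
    proof (intro bexI[of _ "space ?P - ?U"] conjI ballI allI impI)
      show "1 - \<gamma> < measure ?P (space ?P - ?U)" using P.prob_compl[OF Us] Up by simp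
      show "space ?P - ?U \<in> sets ?P" using Us by auto
      fix t x assume "t \<in> space ?P - ?U"
      then have "m * (1 / (4 * s)) < (\<Sum>l<m. X (t l))" using s by (auto simp: EX field_simps)
      also have "\<dots> = (\<Sum>l<m. (cmod (\<psi> j (t l)))\<^sup>2) / s" by (simp add: X_def sum_divide_distrib)
      finally have "m / 4 \<le> (\<Sum>l<m. (cmod (\<psi> j (t l)))\<^sup>2)" using s by (simp add: field_simps)
      then have "9 / 1024 * m \<le> (\<Sum>l<m. (cmod (\<psi> j (t l)))\<^sup>2)" by simp
      then have "(9 / 1024 * m) * (cmod (x j))\<^sup>2 \<le> (\<Sum>l<m. (cmod (\<psi> j (t l)))\<^sup>2) * (cmod (x j))\<^sup>2"
        by (intro mult_right_mono) auto
      then show "9 / 1024 * m * (\<Sum>j\<in>I. (cmod (x j))\<^sup>2) \<le> (\<Sum>l<m. (cmod (\<Sum>j\<in>I. x j * \<psi> j (t l)))\<^sup>2)"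
        by (simp add: j norm_mult power_mult_distrib sum_distrib_left[symmetric] mult.commute)
    qed
  qed
qed

section \<open>Recovery\<close>

lemma residual_norm_triangle:
  "L2_set (\<lambda>l. cmod (\<Sum>j\<in>I. A l j * (z j - z' j))) {..<m} \<le> residual_norm m I A z y + residual_norm m I A z' y"
proof -
  have "L2_set (\<lambda>l. cmod (\<Sum>j\<in>I. A l j * (z j - z' j))) {..<m}
      \<le> L2_set (\<lambda>l. cmod ((\<Sum>j\<in>I. A l j * z j) - y l) + cmod ((\<Sum>j\<in>I. A l j * z' j) - y l)) {..<m}"
  proof (intro L2_set_mono)
    fix l
    have "(\<Sum>j\<in>I. A l j * (z j - z' j)) = ((\<Sum>j\<in>I. A l j * z j) - y l) - ((\<Sum>j\<in>I. A l j * z' j) - y l)"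
      by (simp add: algebra_simps sum_subtractf)
    then show "cmod (\<Sum>j\<in>I. A l j * (z j - z' j)) \<le> cmod ((\<Sum>j\<in>I. A l j * z j) - y l) + cmod ((\<Sum>j\<in>I. A l j * z' j) - y l)"
      by (simp only: norm_triangle_ineq4)
  qed auto
  also have "\<dots> \<le> residual_norm m I A z y + residual_norm m I A z' y"
    unfolding residual_norm_def by (rule L2_set_triangle_ineq)
  finally show ?thesis .
qed

text \<open>Comparing the weighted l1 norms gives
  \<open>a \<le> 2 * sqrt s * n + 2 * \<sigma>\<close>, with \<open>a\<close> and \<open>n\<close>
  the weighted l1 and Euclidean norms of the error. Inside the cone the residuals control
  \<open>n\<close>; outside it \<open>2 * sqrt s * n\<close> is below \<open>2 * a / 3\<close>,
  which leaves \<open>a \<le> 6 * \<sigma>\<close>.\<close>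

lemma weighted_l1_recovery:
  fixes w :: "'i \<Rightarrow> real" and A :: "nat \<Rightarrow> 'i \<Rightarrow> complex" and s \<kappa> :: real
  assumes I: "finite I" and w: "\<And>j. j \<in> I \<Longrightarrow> 0 < w j" and s: "0 < s" and \<kappa>: "0 < \<kappa>" and m: "0 < m"
    and iso: "\<And>x. (\<Sum>j\<in>I. w j * cmod (x j)) \<le> 3 * sqrt s * sqrt (\<Sum>j\<in>I. (cmod (x j))\<^sup>2) \<Longrightarrow>
      \<kappa> * sqrt m * sqrt (\<Sum>j\<in>I. (cmod (x j))\<^sup>2) \<le> L2_set (\<lambda>l. cmod (\<Sum>j\<in>I. A l j * x j)) {..<m}"
    and res: "residual_norm m I A x y \<le> \<eta>" "residual_norm m I A x' y \<le> \<eta>"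
    and le: "(\<Sum>j\<in>I. w j * cmod (x' j)) \<le> (\<Sum>j\<in>I. w j * cmod (x j))"
    and S: "S \<subseteq> I" "(\<Sum>j\<in>S. (w j)\<^sup>2) \<le> s"
  shows "(\<Sum>j\<in>I. w j * cmod (x j - x' j))
    \<le> 6 * (\<Sum>j\<in>I - S. w j * cmod (x j)) + 6 * sqrt s * \<eta> / (\<kappa> * sqrt m)"
proof -
  define z where "z = (\<lambda>j. x j - x' j)"
  define n where "n = sqrt (\<Sum>j\<in>I. (cmod (z j))\<^sup>2)"
  define \<sigma> where "\<sigma> = (\<Sum>j\<in>I - S. w j * cmod (x j))"
  have split: "sum g I = sum g S + sum g (I - S)" for g :: "'i \<Rightarrow> real"
    using sum.subset_diff[OF S(1) I, of g] by simp
  have "(\<Sum>j\<in>S. w j * cmod (x j)) \<le> (\<Sum>j\<in>S. w j * cmod (z j) + w j * cmod (x' j))"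
  proof (intro sum_mono)
    fix j assume "j \<in> S"
    then have "0 < w j" using S w by auto
    then show "w j * cmod (x j) \<le> w j * cmod (z j) + w j * cmod (x' j)"
      using norm_triangle_ineq[of "z j" "x' j"] by (simp add: z_def distrib_left[symmetric])
  qed
  moreover have "(\<Sum>j\<in>I - S. w j * cmod (z j)) \<le> (\<Sum>j\<in>I - S. w j * cmod (x j) + w j * cmod (x' j))"
  proof (intro sum_mono)
    fix j assume "j \<in> I - S"
    then have "0 < w j" using S w by auto
    then show "w j * cmod (z j) \<le> w j * cmod (x j) + w j * cmod (x' j)"
      using norm_triangle_ineq4[of "x j" "x' j"] by (simp add: z_def distrib_left[symmetric])
  qed
  \<comment> \<open>The assumption \<open>le\<close> cancels the contributions of \<open>x'\<close>
    and of \<open>x\<close> on \<open>S\<close>; what remains is \<open>x\<close> off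
    \<open>S\<close>, counted twice.\<close>
  ultimately have off: "(\<Sum>j\<in>I - S. w j * cmod (z j)) \<le> (\<Sum>j\<in>S. w j * cmod (z j)) + 2 * \<sigma>"
    using le split[of "\<lambda>j. w j * cmod (x j)"] split[of "\<lambda>j. w j * cmod (x' j)"]
    by (simp add: sum.distrib \<sigma>_def)
  have "(\<Sum>j\<in>S. w j * cmod (z j)) \<le> (\<Sum>j\<in>S. \<bar>w j\<bar> * \<bar>cmod (z j)\<bar>)"
    by (intro sum_mono) (auto intro!: mult_right_mono)
  \<comment> \<open>Cauchy-Schwarz, with the weighted cardinality of \<open>S\<close> bounded by
    \<open>s\<close>.\<close>
  also have "\<dots> \<le> L2_set w S * L2_set (\<lambda>j. cmod (z j)) S" by (rule L2_set_mult_ineq)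
  also have "\<dots> \<le> sqrt s * n"
    unfolding L2_set_def n_def using S I s
    by (intro mult_mono real_sqrt_le_mono sum_mono2) (auto intro: sum_nonneg)
  finally have on: "(\<Sum>j\<in>S. w j * cmod (z j)) \<le> sqrt s * n" .
  define a where "a = (\<Sum>j\<in>I. w j * cmod (z j))"
  have a: "a \<le> 2 * (sqrt s * n) + 2 * \<sigma>"
    using on off split[of "\<lambda>j. w j * cmod (z j)"] by (simp add: a_def)
  have \<sigma>: "0 \<le> \<sigma>" unfolding \<sigma>_def using w by (intro sum_nonneg) (auto simp: less_imp_le)
  have "0 \<le> residual_norm m I A x y" unfolding residual_norm_def by (rule L2_set_nonneg)
  then have \<eta>: "0 \<le> \<eta>" using res by linarith
  have \<kappa>m: "0 < \<kappa> * sqrt m" using \<kappa> m by simp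
  have "a \<le> 6 * \<sigma> + 6 * sqrt s * \<eta> / (\<kappa> * sqrt m)"
  proof (cases "a \<le> 3 * sqrt s * n")
    case True
    then have "\<kappa> * sqrt m * n \<le> L2_set (\<lambda>l. cmod (\<Sum>j\<in>I. A l j * z j)) {..<m}"
      unfolding n_def a_def by (rule iso)
    also have "\<dots> \<le> 2 * \<eta>"
      using residual_norm_triangle[where A=A and I=I and z=x and z'=x' and m=m and y=y] res unfolding z_def by linarith
    finally have n: "n \<le> 2 * \<eta> / (\<kappa> * sqrt m)" using \<kappa>m by (simp add: field_simps)
    have "a \<le> 3 * sqrt s * (2 * \<eta> / (\<kappa> * sqrt m))"
      using s by (intro order_trans[OF True] mult_left_mono n) auto
    then show ?thesis using \<sigma> by simp
  next
    case False
    then have "a \<le> 6 * \<sigma>" using a by simp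
    moreover have "0 \<le> 6 * sqrt s * \<eta> / (\<kappa> * sqrt m)" using s \<eta> \<kappa>m by (intro divide_nonneg_pos) auto
    ultimately show ?thesis by linarith
  qed
  then show ?thesis by (simp add: a_def z_def \<sigma>_def)
qed

text \<open>\<open>S\<close> collects the indices where \<open>cmod (x j) / w j\<close> is at least
  a threshold. Markov's inequality for the weights \<open>(w j)\<^sup>2\<close> bounds the weighted
  size of \<open>S\<close>, and off \<open>S\<close> the factor
  \<open>cmod (x j) powr (1 - p)\<close> is bounded through the threshold. No rearrangement is
  required.\<close>

lemma weighted_stechkin:
  fixes w :: "'i \<Rightarrow> real" and x :: "'i \<Rightarrow> complex" and s p K :: real
  assumes I: "finite I" and w: "\<And>j. j \<in> I \<Longrightarrow> 0 < w j" and p: "0 < p" "p \<le> 1" and s: "0 < s" and K: "0 \<le> K"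
    and x: "(\<Sum>j\<in>I. w j powr (2 - p) * cmod (x j) powr p) \<le> K powr p"
  shows "\<exists>S\<subseteq>I. (\<Sum>j\<in>S. (w j)\<^sup>2) \<le> s \<and> (\<Sum>j\<in>I - S. w j * cmod (x j)) \<le> s powr (1 - 1 / p) * K"
\<comment> \<open>For \<open>K = 0\<close> the threshold would vanish and select all of
  \<open>I\<close>, whose weighted size may exceed \<open>s\<close>; the empty set serves
  instead.\<close>
proof (cases "K = 0")
  case True
  have "(\<Sum>j\<in>I. w j powr (2 - p) * cmod (x j) powr p) = 0"
    using x True by (intro antisym sum_nonneg) auto
  then have "\<forall>j\<in>I. w j powr (2 - p) * cmod (x j) powr p = 0"
    by (subst (asm) sum_nonneg_eq_0_iff) (use I in auto)
  then have "\<forall>j\<in>I. cmod (x j) = 0" using w by fastforce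
  then show ?thesis using True s by (intro exI[of _ "{}"]) auto
next
  case False
  then have K: "0 < K" using K by simp
  \<comment> \<open>Chosen so that \<open>K powr p / \<theta> powr p = s\<close>, the exact bound
    for the weighted size of \<open>S\<close>.\<close>
  define \<theta> where "\<theta> = K / s powr (1 / p)"
  have \<theta>: "0 < \<theta>" using K s by (simp add: \<theta>_def)
  have \<theta>p: "\<theta> powr p = K powr p / s"
    using K s p by (simp add: \<theta>_def powr_divide powr_powr)
  define S where "S = {j \<in> I. \<theta> * w j \<le> cmod (x j)}"
  have "(\<Sum>j\<in>S. (w j)\<^sup>2) \<le> (\<Sum>j\<in>S. w j powr (2 - p) * cmod (x j) powr p / \<theta> powr p)"
  proof (intro sum_mono)
    fix j assume j: "j \<in> S"
    then have wj: "0 < w j" and xj: "\<theta> * w j \<le> cmod (x j)" using w by (auto simp: S_def)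
    have "(w j)\<^sup>2 = w j powr (2 - p) * (\<theta> * w j) powr p / \<theta> powr p"
      using wj \<theta> by (simp add: powr_mult powr_add[symmetric])
    also have "\<dots> \<le> w j powr (2 - p) * cmod (x j) powr p / \<theta> powr p"
      using wj \<theta> p xj by (intro divide_right_mono mult_left_mono powr_mono2) auto
    finally show "(w j)\<^sup>2 \<le> w j powr (2 - p) * cmod (x j) powr p / \<theta> powr p" .
  qed
  also have "\<dots> \<le> (\<Sum>j\<in>I. w j powr (2 - p) * cmod (x j) powr p / \<theta> powr p)"
    using I by (intro sum_mono2) (auto simp: S_def)
  also have "\<dots> = (\<Sum>j\<in>I. w j powr (2 - p) * cmod (x j) powr p) / \<theta> powr p"
    by (simp add: sum_divide_distrib)
  also have "\<dots> \<le> K powr p / \<theta> powr p" using x by (intro divide_right_mono) auto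
  also have "\<dots> = s" using K s by (simp add: \<theta>p)
  finally have 1: "(\<Sum>j\<in>S. (w j)\<^sup>2) \<le> s" .
  have "(\<Sum>j\<in>I - S. w j * cmod (x j)) \<le> (\<Sum>j\<in>I - S. \<theta> powr (1 - p) * (w j powr (2 - p) * cmod (x j) powr p))"
  proof (intro sum_mono)
    fix j assume "j \<in> I - S"
    then have wj: "0 < w j" and xj: "cmod (x j) \<le> \<theta> * w j" using w by (auto simp: S_def)
    show "w j * cmod (x j) \<le> \<theta> powr (1 - p) * (w j powr (2 - p) * cmod (x j) powr p)"
    proof (cases "x j = 0")
      case False
      then have "w j * cmod (x j) = w j * (cmod (x j) powr (1 - p) * cmod (x j) powr p)"
        by (simp add: powr_add[symmetric])
      also have "\<dots> \<le> w j * ((\<theta> * w j) powr (1 - p) * cmod (x j) powr p)"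
        using wj xj p by (intro mult_left_mono mult_right_mono powr_mono2) auto
      also have "\<dots> = \<theta> powr (1 - p) * ((w j powr 1 * w j powr (1 - p)) * cmod (x j) powr p)"
        using wj \<theta> by (simp add: powr_mult)
      also have "w j powr 1 * w j powr (1 - p) = w j powr (2 - p)" by (simp only: powr_add[symmetric]) simp
      finally show ?thesis .
    qed simp
  qed
  also have "\<dots> \<le> (\<Sum>j\<in>I. \<theta> powr (1 - p) * (w j powr (2 - p) * cmod (x j) powr p))"
    using I by (intro sum_mono2) auto
  also have "\<dots> \<le> \<theta> powr (1 - p) * K powr p"
    unfolding sum_distrib_left[symmetric] using x by (intro mult_left_mono) auto
  also have "\<theta> powr (1 - p) = K powr (1 - p) * s powr (1 - 1 / p)"
  proof -
    have "(1 - p) / p = - (1 - 1 / p)" using p by (simp add: field_simps)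
    then have "s powr ((1 - p) / p) = 1 / s powr (1 - 1 / p)" by (simp only: powr_minus_divide)
    then show ?thesis
      using K s by (simp add: \<theta>_def powr_divide powr_powr)
  qed
  also have "K powr (1 - p) * s powr (1 - 1 / p) * K powr p = s powr (1 - 1 / p) * K"
    using K by (simp add: powr_add[symmetric] mult.commute mult.left_commute)
  finally have 2: "(\<Sum>j\<in>I - S. w j * cmod (x j)) \<le> s powr (1 - 1 / p) * K" .
  show ?thesis using 1 2 by (intro exI[of _ S]) (auto simp: S_def)
qed

section \<open>The truncated index set and the tail of the expansion\<close>

lemma powr_inverse_le:
  fixes y Y p :: real
  assumes "0 \<le> y" "y \<le> Y" "0 < p" "p \<le> 1"
  shows "y powr (1 / p) \<le> Y powr (1 / p - 1) * y"
proof (cases "y = 0")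
  case False
  then have "y powr (1 / p) = y powr (1 / p - 1) * y"
    using assms powr_add[of y "1 / p - 1" 1] by simp
  also have "\<dots> \<le> Y powr (1 / p - 1) * y"
    using assms by (intro mult_right_mono powr_mono2) (auto simp: field_simps)
  finally show ?thesis .
qed (use assms in auto)

text \<open>The lower bound on \<open>v\<close> gives \<open>\<omega> * v powr (1 - 2 / p) \<le> (2
  * \<omega>) powr (1 - 2 / p)\<close>, the power of exponent \<open>1 / 2 - 1 / p\<close> of
  \<open>(2 * \<omega>)\<^sup>2\<close>. As that exponent is negative,
  \<open>s < (2 * \<omega>)\<^sup>2\<close> would contradict the truncation rule.\<close>

lemma truncated_weight_bound:
  fixes \<omega> v s p :: real
  assumes \<omega>: "1 \<le> \<omega>" and v: "2 * \<omega> powr (1 / (1 - p / 2)) \<le> v" and p: "0 < p" "p \<le> 1" and s: "0 < s"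
    and le: "s powr (1 / 2 - 1 / p) \<le> \<omega> * v powr (1 - 2 / p)"
  shows "4 * \<omega>\<^sup>2 \<le> s"
proof (rule ccontr)
  assume "\<not> ?thesis"
  then have lt: "s < (2 * \<omega>)\<^sup>2" by (simp add: power_mult_distrib)
  have e: "1 / 2 - 1 / p < 0" "1 - 2 / p \<le> 0" using p by (auto simp: field_simps)
  have e2: "(1 - 2 / p) / (1 - p / 2) = - (2 / p)" using p by (simp add: field_simps)
  have "\<omega> * v powr (1 - 2 / p) \<le> \<omega> * (2 * \<omega> powr (1 / (1 - p / 2))) powr (1 - 2 / p)"
    using \<omega> v e by (intro mult_left_mono powr_mono2') auto
  also have "\<dots> = 2 powr (1 - 2 / p) * (\<omega> powr 1 * \<omega> powr (- 2 / p))"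
    using \<omega> by (simp add: powr_mult powr_powr e2)
  also have "\<dots> = (2 * \<omega>) powr (1 - 2 / p)"
    using \<omega> by (simp only: powr_add[symmetric]) (simp add: powr_mult)
  also have "\<dots> = ((2 * \<omega>) powr 2) powr (1 / 2 - 1 / p)"
    by (simp add: powr_powr algebra_simps)
  also have "\<dots> < s powr (1 / 2 - 1 / p)"
    using \<omega> s lt e by (intro powr_less_mono2_neg) auto
  finally show False using le by simp
qed

text \<open>Off \<open>\<Lambda>\<^sub>0\<close> the weight \<open>\<omega> j\<close> is below
  \<open>s powr (1 / 2 - 1 / p) * v j powr (2 / p - 1)\<close>, and
  \<open>v j powr (2 / p - 1) * cmod (x j)\<close> is the \<open>1 / p\<close> power of the j-th
  term of the norm. For \<open>p \<le> 1\<close> these powers are summable by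
  \<open>powr_inverse_le\<close>.\<close>

lemma expansion_tail:
  fixes \<psi> :: "'i \<Rightarrow> 'a \<Rightarrow> complex" and x :: "'i \<Rightarrow> complex"
  assumes p: "0 < p" "p \<le> 1" and s: "1 \<le> s"
    and \<omega>: "\<And>j. j \<in> \<Lambda> \<Longrightarrow> 1 \<le> \<omega> j" and v: "\<And>j. j \<in> \<Lambda> \<Longrightarrow> 1 \<le> v j"
    and fin: "finite \<Lambda>\<^sub>0" and \<Lambda>\<^sub>0: "\<Lambda>\<^sub>0 = truncated_index_set \<Lambda> \<omega> v s p"
    and \<psi>: "\<And>j. j \<in> \<Lambda> \<Longrightarrow> cmod (\<psi> j u) \<le> \<omega> j"
    and x: "weighted_norm_finite \<Lambda> v p x"
  shows "cmod (expansion \<Lambda> \<psi> x u - (\<Sum>j\<in>\<Lambda>\<^sub>0. x j * \<psi> j u))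
    \<le> real s powr (1 / 2 - 1 / p) * weighted_norm \<Lambda> v p x"
proof -
  define T where "T = \<Lambda> - \<Lambda>\<^sub>0"
  have sub: "\<Lambda>\<^sub>0 \<subseteq> \<Lambda>" by (auto simp: \<Lambda>\<^sub>0 truncated_index_set_def)
  define y where "y = (\<lambda>j. v j powr (2 - p) * cmod (x j) powr p)"
  have ysum: "y summable_on \<Lambda>" using x by (simp add: weighted_norm_finite_def y_def)
  have y0: "0 \<le> y j" for j by (simp add: y_def)
  define Y where "Y = infsum y \<Lambda>"
  have yY: "y j \<le> Y" if "j \<in> \<Lambda>" for j
    unfolding Y_def using that ysum y0 finite_sum_le_infsum[of y \<Lambda> "{j}"] by simp
  have Y0: "0 \<le> Y" unfolding Y_def by (intro infsum_nonneg y0)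
  define c where "c = real s powr (1 / 2 - 1 / p) * Y powr (1 / p - 1)"
  have bnd: "norm (x j * \<psi> j u) \<le> c * y j" if j: "j \<in> T" for j
  proof -
    have jL: "j \<in> \<Lambda>" using j by (simp add: T_def)
    have vj: "0 < v j" using v[OF jL] by simp
    have "\<omega> j * v j powr (1 - 2 / p) < real s powr (1 / 2 - 1 / p)"
      using j jL by (auto simp: T_def \<Lambda>\<^sub>0 truncated_index_set_def)
    then have "\<omega> j * v j powr (1 - 2 / p) * v j powr (2 / p - 1) \<le> real s powr (1 / 2 - 1 / p) * v j powr (2 / p - 1)"
      by (intro mult_right_mono) auto
    moreover have "v j powr (1 - 2 / p) * v j powr (2 / p - 1) = 1"
      using vj by (simp add: powr_add[symmetric])
    ultimately have \<omega>j: "\<omega> j \<le> real s powr (1 / 2 - 1 / p) * v j powr (2 / p - 1)"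
      by (simp add: mult.assoc)
    have "(2 - p) / p = 2 / p - 1" using p by (simp add: field_simps)
    then have yp: "y j powr (1 / p) = v j powr (2 / p - 1) * cmod (x j)"
      using p by (simp add: y_def powr_mult powr_powr)
    have "norm (x j * \<psi> j u) \<le> cmod (x j) * \<omega> j"
      using \<psi>[OF jL] by (simp add: norm_mult mult_left_mono)
    also have "\<dots> \<le> cmod (x j) * (real s powr (1 / 2 - 1 / p) * v j powr (2 / p - 1))"
      by (intro mult_left_mono \<omega>j) auto
    also have "\<dots> = real s powr (1 / 2 - 1 / p) * y j powr (1 / p)" by (simp add: yp)
    also have "\<dots> \<le> real s powr (1 / 2 - 1 / p) * (Y powr (1 / p - 1) * y j)"
      by (intro mult_left_mono powr_inverse_le y0 yY jL p) auto
    finally show ?thesis by (simp add: c_def mult.assoc)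
  qed
  have yT: "y summable_on T" using ysum by (rule summable_on_subset_banach) (auto simp: T_def)
  then have cyT: "(\<lambda>j. c * y j) summable_on T" by (rule summable_on_cmult_right)
  \<comment> \<open>Absolute convergence makes the splitting of the \<open>infsum\<close>
    legitimate, so \<open>expansion\<close> is not the default value 0 of a divergent sum.\<close>
  have abs: "(\<lambda>j. norm (x j * \<psi> j u)) summable_on T"
    using cyT bnd by (rule Infinite_Sum.abs_summable_on_comparison_test')
  have "expansion \<Lambda> \<psi> x u = (\<Sum>\<^sub>\<infinity>j\<in>\<Lambda>\<^sub>0 \<union> T. x j * \<psi> j u)"
    using sub by (simp add: expansion_def T_def Un_absorb1)
  also have "\<dots> = (\<Sum>\<^sub>\<infinity>j\<in>\<Lambda>\<^sub>0. x j * \<psi> j u) + (\<Sum>\<^sub>\<infinity>j\<in>T. x j * \<psi> j u)"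
    by (rule infsum_Un_disjoint[OF summable_on_finite[OF fin] abs_summable_summable[OF abs]]) (auto simp: T_def)
  finally have "expansion \<Lambda> \<psi> x u - (\<Sum>j\<in>\<Lambda>\<^sub>0. x j * \<psi> j u) = (\<Sum>\<^sub>\<infinity>j\<in>T. x j * \<psi> j u)"
    using fin by simp
  then have "cmod (expansion \<Lambda> \<psi> x u - (\<Sum>j\<in>\<Lambda>\<^sub>0. x j * \<psi> j u)) \<le> (\<Sum>\<^sub>\<infinity>j\<in>T. norm (x j * \<psi> j u))"
    using norm_infsum_bound[OF abs] by simp
  also have "\<dots> \<le> (\<Sum>\<^sub>\<infinity>j\<in>T. c * y j)"
    using abs cyT bnd by (intro infsum_mono) auto
  also have "\<dots> = c * infsum y T" by (rule infsum_cmult_right')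
  also have "\<dots> \<le> c * Y"
    unfolding Y_def using ysum yT y0
    by (intro mult_left_mono infsum_mono_neutral) (auto simp: T_def c_def)
  also have "\<dots> = real s powr (1 / 2 - 1 / p) * (Y powr (1 / p - 1) * Y powr 1)"
    using Y0 by (simp add: c_def)
  also have "Y powr (1 / p - 1) * Y powr 1 = weighted_norm \<Lambda> v p x"
    unfolding powr_add[symmetric] by (simp add: weighted_norm_def Y_def y_def)
  finally show ?thesis .
qed

section \<open>Assembly of the error bound\<close>

lemma weighted_norm_one:
  assumes "finite I" "\<And>j. j \<in> I \<Longrightarrow> 0 \<le> w j"
  shows "weighted_norm I w 1 x = (\<Sum>j\<in>I. w j * cmod (x j))"
proof -
  have "0 \<le> (\<Sum>j\<in>I. w j * cmod (x j))" using assms by (intro sum_nonneg) auto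
  then show ?thesis using assms by (simp add: weighted_norm_def)
qed

text \<open>The error splits into the tail and the coefficient error on
  \<open>\<Lambda>\<^sub>0\<close>, whose sup norm is at most its weighted l1 norm. In the constant,
  1 comes from the tail, 6 from best approximation and \<open>64 * \<tau>\<close> from the
  residual.\<close>

lemma recovery_sup_norm:
  fixes \<psi> :: "'i \<Rightarrow> 'a \<Rightarrow> complex" and x x' :: "'i \<Rightarrow> complex" and s m :: nat
  assumes p: "0 < p" "p \<le> 1" and s: "1 \<le> s" and m: "0 < m" and \<tau>: "1 \<le> \<tau>"
    and \<omega>: "\<And>j. j \<in> \<Lambda> \<Longrightarrow> 1 \<le> \<omega> j" and v: "\<And>j. j \<in> \<Lambda> \<Longrightarrow> \<omega> j \<le> v j"
    and fin: "finite \<Lambda>\<^sub>0" and \<Lambda>\<^sub>0: "\<Lambda>\<^sub>0 = truncated_index_set \<Lambda> \<omega> v s p"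
    and \<psi>: "\<And>j u. j \<in> \<Lambda> \<Longrightarrow> u \<in> D \<Longrightarrow> cmod (\<psi> j u) \<le> \<omega> j"
    and t: "\<And>l. l < m \<Longrightarrow> t l \<in> D"
    and iso: "\<And>z. (\<Sum>j\<in>\<Lambda>\<^sub>0. \<omega> j * cmod (z j)) \<le> 3 * sqrt s * sqrt (\<Sum>j\<in>\<Lambda>\<^sub>0. (cmod (z j))\<^sup>2) \<Longrightarrow>
      9 / 1024 * m * (\<Sum>j\<in>\<Lambda>\<^sub>0. (cmod (z j))\<^sup>2) \<le> (\<Sum>l<m. (cmod (\<Sum>j\<in>\<Lambda>\<^sub>0. z j * \<psi> j (t l)))\<^sup>2)"
    and x: "weighted_norm_finite \<Lambda> v p x"
    and x': "is_weighted_l1_solution m \<Lambda>\<^sub>0 \<omega> (sampling_matrix \<psi> t) (\<lambda>l. expansion \<Lambda> \<psi> x (t l))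
      (\<tau> * real s powr (1 / 2 - 1 / p) * sqrt m * weighted_norm \<Lambda> v p x) x'"
    and u: "u \<in> D"
  shows "cmod (expansion \<Lambda> \<psi> x u - expansion \<Lambda>\<^sub>0 \<psi> x' u)
    \<le> (7 + 64 * \<tau>) * real s powr (1 - 1 / p) * weighted_norm \<Lambda> v p x"
proof -
  define K where "K = weighted_norm \<Lambda> v p x"
  define A where "A = sampling_matrix \<psi> t"
  define y where "y = (\<lambda>l. expansion \<Lambda> \<psi> x (t l))"
  define b where "b = real s powr (1 / 2 - 1 / p) * K"
  define \<eta> where "\<eta> = \<tau> * real s powr (1 / 2 - 1 / p) * sqrt m * K"
  have K: "0 \<le> K" by (simp add: K_def weighted_norm_def)
  have b: "0 \<le> b" using K by (simp add: b_def)
  have sub: "\<Lambda>\<^sub>0 \<subseteq> \<Lambda>" by (auto simp: \<Lambda>\<^sub>0 truncated_index_set_def)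
  have \<omega>0: "0 < \<omega> j" if "j \<in> \<Lambda>\<^sub>0" for j using \<omega>[of j] sub that by auto
  have v1: "1 \<le> v j" if "j \<in> \<Lambda>" for j using \<omega>[OF that] v[OF that] by simp
  have tail: "cmod (expansion \<Lambda> \<psi> x u - (\<Sum>j\<in>\<Lambda>\<^sub>0. x j * \<psi> j u)) \<le> b" if "u \<in> D" for u
    unfolding b_def K_def using \<psi> that by (intro expansion_tail[where \<omega>=\<omega>] p s \<omega> v1 fin \<Lambda>\<^sub>0 x) auto
  \<comment> \<open>The true coefficients are feasible: at each sample point the residual is the
    tail, and \<open>\<tau> \<ge> 1\<close>. Minimality of \<open>x'\<close> can thus be tested
    against \<open>x\<close>.\<close>
  have resx: "residual_norm m \<Lambda>\<^sub>0 A x y \<le> \<eta>"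
  proof -
    have "residual_norm m \<Lambda>\<^sub>0 A x y \<le> L2_set (\<lambda>l. b) {..<m}"
      unfolding residual_norm_def
    proof (intro L2_set_mono)
      fix l assume "l \<in> {..<m}"
      then show "cmod ((\<Sum>j\<in>\<Lambda>\<^sub>0. A l j * x j) - y l) \<le> b"
        using tail[OF t[of l]]
        by (simp add: A_def y_def sampling_matrix_def mult.commute norm_minus_commute)
    qed simp
    also have "\<dots> = 1 * (sqrt m * b)" using b by (simp add: L2_set_constant)
    also have "\<dots> \<le> \<tau> * (sqrt m * b)" using \<tau> b by (intro mult_right_mono) auto
    finally show ?thesis by (simp add: \<eta>_def b_def algebra_simps)
  qed
  have sol: "is_arg_min (weighted_norm \<Lambda>\<^sub>0 \<omega> 1) (\<lambda>z. residual_norm m \<Lambda>\<^sub>0 A z y \<le> \<eta>) x'"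
    using x' by (simp add: is_weighted_l1_solution_def A_def y_def \<eta>_def K_def)
  then have resx': "residual_norm m \<Lambda>\<^sub>0 A x' y \<le> \<eta>"
    and "\<not> weighted_norm \<Lambda>\<^sub>0 \<omega> 1 x < weighted_norm \<Lambda>\<^sub>0 \<omega> 1 x'"
    using resx by (auto simp: is_arg_min_def)
  then have le: "(\<Sum>j\<in>\<Lambda>\<^sub>0. \<omega> j * cmod (x' j)) \<le> (\<Sum>j\<in>\<Lambda>\<^sub>0. \<omega> j * cmod (x j))"
    using weighted_norm_one[OF fin, of \<omega>] \<omega>0 by (simp add: less_imp_le)
  have "(\<Sum>j\<in>\<Lambda>\<^sub>0. \<omega> j powr (2 - p) * cmod (x j) powr p) \<le> (\<Sum>j\<in>\<Lambda>\<^sub>0. v j powr (2 - p) * cmod (x j) powr p)"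
    using \<omega>0 v sub p by (intro sum_mono mult_right_mono powr_mono2) (auto simp: less_imp_le)
  also have "\<dots> \<le> (\<Sum>\<^sub>\<infinity>j\<in>\<Lambda>. v j powr (2 - p) * cmod (x j) powr p)"
    using x fin sub by (intro finite_sum_le_infsum) (auto simp: weighted_norm_finite_def)
  also have "\<dots> = K powr p"
    using p by (simp add: K_def weighted_norm_def powr_powr infsum_nonneg)
  finally have Kp: "(\<Sum>j\<in>\<Lambda>\<^sub>0. \<omega> j powr (2 - p) * cmod (x j) powr p) \<le> K powr p" .
  have s0: "0 < real s" using s by simp
  obtain S where S: "S \<subseteq> \<Lambda>\<^sub>0" "(\<Sum>j\<in>S. (\<omega> j)\<^sup>2) \<le> s"
    and \<sigma>: "(\<Sum>j\<in>\<Lambda>\<^sub>0 - S. \<omega> j * cmod (x j)) \<le> real s powr (1 - 1 / p) * K"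
    using weighted_stechkin[OF fin \<omega>0 p s0 K Kp] by blast
  have "(\<Sum>j\<in>\<Lambda>\<^sub>0. \<omega> j * cmod (x j - x' j))
      \<le> 6 * (\<Sum>j\<in>\<Lambda>\<^sub>0 - S. \<omega> j * cmod (x j)) + 6 * sqrt s * \<eta> / (3 / 32 * sqrt m)"
  proof (rule weighted_l1_recovery[OF fin \<omega>0 s0 _ m _ resx resx' le S])
    fix z assume "(\<Sum>j\<in>\<Lambda>\<^sub>0. \<omega> j * cmod (z j)) \<le> 3 * sqrt s * sqrt (\<Sum>j\<in>\<Lambda>\<^sub>0. (cmod (z j))\<^sup>2)"
    from iso[OF this]
    have "(3 / 32 * sqrt m * sqrt (\<Sum>j\<in>\<Lambda>\<^sub>0. (cmod (z j))\<^sup>2))\<^sup>2 \<le> (\<Sum>l<m. (cmod (\<Sum>j\<in>\<Lambda>\<^sub>0. A l j * z j))\<^sup>2)"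
      by (simp add: power_mult_distrib sum_nonneg A_def sampling_matrix_def mult.commute power_divide)
    then show "3 / 32 * sqrt m * sqrt (\<Sum>j\<in>\<Lambda>\<^sub>0. (cmod (z j))\<^sup>2) \<le> L2_set (\<lambda>l. cmod (\<Sum>j\<in>\<Lambda>\<^sub>0. A l j * z j)) {..<m}"
      unfolding L2_set_def by (rule real_le_rsqrt)
  qed auto
  also have "6 * sqrt s * \<eta> / (3 / 32 * sqrt m) = 64 * \<tau> * (sqrt s * real s powr (1 / 2 - 1 / p)) * K"
    using m by (simp add: \<eta>_def)
  also have "sqrt s * real s powr (1 / 2 - 1 / p) = real s powr (1 - 1 / p)"
    using s0 by (simp add: powr_half_sqrt[symmetric] powr_add[symmetric])
  finally have l1: "(\<Sum>j\<in>\<Lambda>\<^sub>0. \<omega> j * cmod (x j - x' j)) \<le> (6 + 64 * \<tau>) * real s powr (1 - 1 / p) * K"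
    using \<sigma> by (simp add: algebra_simps)
  have split: "expansion \<Lambda> \<psi> x u - expansion \<Lambda>\<^sub>0 \<psi> x' u
      = (expansion \<Lambda> \<psi> x u - (\<Sum>j\<in>\<Lambda>\<^sub>0. x j * \<psi> j u)) + (\<Sum>j\<in>\<Lambda>\<^sub>0. (x j - x' j) * \<psi> j u)"
    using fin by (simp add: expansion_def[of \<Lambda>\<^sub>0] algebra_simps sum_subtractf)
  have "cmod (expansion \<Lambda> \<psi> x u - expansion \<Lambda>\<^sub>0 \<psi> x' u)
      \<le> b + cmod (\<Sum>j\<in>\<Lambda>\<^sub>0. (x j - x' j) * \<psi> j u)"
    unfolding split by (rule norm_triangle_mono[OF tail[OF u] order_refl])
  also have "\<dots> \<le> b + (\<Sum>j\<in>\<Lambda>\<^sub>0. \<omega> j * cmod (x j - x' j))"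
  proof (intro add_left_mono order_trans[OF norm_sum] sum_mono)
    fix j assume "j \<in> \<Lambda>\<^sub>0"
    then have "cmod (\<psi> j u) \<le> \<omega> j" using sub u \<psi> by auto
    then have "cmod (\<psi> j u) * cmod (x j - x' j) \<le> \<omega> j * cmod (x j - x' j)" by (rule mult_right_mono) simp
    then show "cmod ((x j - x' j) * \<psi> j u) \<le> \<omega> j * cmod (x j - x' j)" by (simp add: norm_mult mult.commute)
  qed
  \<comment> \<open>The tail is smaller than the target by a factor \<open>sqrt s\<close>, and
    \<open>s \<ge> 1\<close>.\<close>
  also have "b \<le> real s powr (1 - 1 / p) * K"
    unfolding b_def using s K by (intro mult_right_mono powr_mono) auto
  finally show ?thesis using l1 by (simp add: K_def[symmetric] algebra_simps)
qed

theorem theorem6p4: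
  "\<exists>(c\<^sub>0::real) (C :: real \<Rightarrow> real). c\<^sub>0 > 0 \<and> (\<forall>\<tau>\<ge>1. C \<tau> > 0) \<and>
    (\<forall>(d::nat) (D :: (nat \<Rightarrow> real) set) (\<nu> :: (nat \<Rightarrow> real) measure)
       (\<Lambda> :: nat set) (\<psi> :: nat \<Rightarrow> (nat \<Rightarrow> real) \<Rightarrow> complex)
       (p::real) (\<omega> :: nat \<Rightarrow> real) (v :: nat \<Rightarrow> real)
       (s::nat) (\<Lambda>\<^sub>0 :: nat set) (N::nat) (\<gamma>::real) (m::nat).
      bounded_domain d D \<longrightarrow>
      orthonormal_system D \<nu> \<Lambda> \<psi> \<longrightarrow>
      0 < p \<and> p \<le> 1 \<longrightarrow>
      weight_on \<Lambda> \<omega> \<longrightarrow>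
      weight_on \<Lambda> v \<longrightarrow>
      (\<forall>j\<in>\<Lambda>. sup_norm D (\<psi> j) \<le> ennreal (\<omega> j)) \<longrightarrow>
      (\<forall>j\<in>\<Lambda>. v j \<ge> 2 * \<omega> j powr (1 / (1 - p / 2))) \<longrightarrow>
      s \<ge> 1 \<longrightarrow>
      \<Lambda>\<^sub>0 = truncated_index_set \<Lambda> \<omega> v s p \<longrightarrow>
      finite \<Lambda>\<^sub>0 \<and> \<Lambda>\<^sub>0 \<noteq> {} \<longrightarrow>
      N = card \<Lambda>\<^sub>0 \<longrightarrow>
      0 < \<gamma> \<and> \<gamma> < 1 \<longrightarrow>
      real m \<ge> c\<^sub>0 * real s * max ((ln (real s)) ^ 3 * ln (real N)) (ln (1 / \<gamma>)) \<longrightarrow>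
      (\<exists>E \<in> sets (Pi\<^sub>M {..<m} (\<lambda>_. \<nu>)).
        measure (Pi\<^sub>M {..<m} (\<lambda>_. \<nu>)) E > 1 - \<gamma> \<and>
        (\<forall>t\<in>E. \<forall>x :: nat \<Rightarrow> complex. weighted_norm_finite \<Lambda> v p x \<longrightarrow>
          (let f = expansion \<Lambda> \<psi> x;
               f_norm = weighted_norm \<Lambda> v p x;
               y = (\<lambda>l. f (t l));
               A = sampling_matrix \<psi> t
           in \<forall>\<tau>\<ge>1. \<forall>x' :: nat \<Rightarrow> complex.
                is_weighted_l1_solution m \<Lambda>\<^sub>0 \<omega> A y
                  (\<tau> * real s powr (1 / 2 - 1 / p) * sqrt (real m) * f_norm) x' \<longrightarrow>
                sup_norm D (\<lambda>u. f u - expansion \<Lambda>\<^sub>0 \<psi> x' u)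
                  \<le> ennreal (C \<tau> * real s powr (1 - 1 / p) * f_norm)))))"
proof (intro exI[of _ "10 ^ 9 :: real"] exI[of _ "\<lambda>\<tau>. 7 + 64 * \<tau>"] conjI allI impI)
  fix d :: nat and D :: "(nat \<Rightarrow> real) set" and \<nu> :: "(nat \<Rightarrow> real) measure"
    and \<Lambda> :: "nat set" and \<psi> :: "nat \<Rightarrow> (nat \<Rightarrow> real) \<Rightarrow> complex"
    and p :: real and \<omega> v :: "nat \<Rightarrow> real" and s :: nat and \<Lambda>\<^sub>0 :: "nat set"
    and N :: nat and \<gamma> :: real and m :: nat
  assume os: "orthonormal_system D \<nu> \<Lambda> \<psi>" and p: "0 < p \<and> p \<le> 1"
    and \<omega>1: "weight_on \<Lambda> \<omega>"
    and sup: "\<forall>j\<in>\<Lambda>. sup_norm D (\<psi> j) \<le> ennreal (\<omega> j)"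
    and v: "\<forall>j\<in>\<Lambda>. v j \<ge> 2 * \<omega> j powr (1 / (1 - p / 2))"
    and s: "s \<ge> 1" and \<Lambda>\<^sub>0: "\<Lambda>\<^sub>0 = truncated_index_set \<Lambda> \<omega> v s p"
    and fin: "finite \<Lambda>\<^sub>0 \<and> \<Lambda>\<^sub>0 \<noteq> {}" and N: "N = card \<Lambda>\<^sub>0" and \<gamma>: "0 < \<gamma> \<and> \<gamma> < 1"
    and m: "real m \<ge> 10 ^ 9 * real s * max ((ln (real s)) ^ 3 * ln (real N)) (ln (1 / \<gamma>))"
  let ?P = "Pi\<^sub>M {..<m} (\<lambda>_. \<nu>)"
  have sub: "\<Lambda>\<^sub>0 \<subseteq> \<Lambda>" by (auto simp: \<Lambda>\<^sub>0 truncated_index_set_def)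
  have M: "prob_space \<nu>" and D: "space \<nu> = D"
    and mes: "\<And>j. j \<in> \<Lambda> \<Longrightarrow> \<psi> j \<in> borel_measurable \<nu>"
    and orth: "\<And>j k. j \<in> \<Lambda> \<Longrightarrow> k \<in> \<Lambda> \<Longrightarrow> (\<integral>u. \<psi> j u * cnj (\<psi> k u) \<partial>\<nu>) = (if j = k then 1 else 0)"
    using os by (auto simp: orthonormal_system_def)
  have \<omega>: "1 \<le> \<omega> j" if "j \<in> \<Lambda>" for j using \<omega>1 that by (simp add: weight_on_def)
  have \<omega>v: "\<omega> j \<le> v j" if j: "j \<in> \<Lambda>" for j
  proof -
    have "1 \<le> 1 / (1 - p / 2)" using p by (simp add: field_simps)
    then have "\<omega> j powr 1 \<le> \<omega> j powr (1 / (1 - p / 2))" using \<omega>[OF j] by (intro powr_mono) auto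
    also have "\<dots> \<le> 2 * \<omega> j powr (1 / (1 - p / 2))" by simp
    also have "\<dots> \<le> v j" using v j by blast
    finally show ?thesis using \<omega>[OF j] by simp
  qed
  have \<psi>: "cmod (\<psi> j u) \<le> \<omega> j" if j: "j \<in> \<Lambda>" and u: "u \<in> D" for j u
  proof -
    have "ennreal (cmod (\<psi> j u)) \<le> sup_norm D (\<psi> j)" unfolding sup_norm_def using u by (rule SUP_upper)
    also have "\<dots> \<le> ennreal (\<omega> j)" using sup j by blast
    finally show ?thesis using \<omega>[OF j] by (subst (asm) ennreal_le_iff) auto
  qed
  have \<omega>s: "4 * (\<omega> j)\<^sup>2 \<le> s" if j: "j \<in> \<Lambda>\<^sub>0" for j
    using j \<omega> v p s by (intro truncated_weight_bound[of "\<omega> j" p "v j"]) (auto simp: \<Lambda>\<^sub>0 truncated_index_set_def)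
  \<comment> \<open>A nonempty \<open>\<Lambda>\<^sub>0\<close> excludes small \<open>s\<close>,
    since its weights are at least 1 and satisfy
    \<open>4 * (\<omega> j)\<^sup>2 \<le> s\<close>.\<close>
  have s4: "4 \<le> real s"
  proof -
    obtain j where j: "j \<in> \<Lambda>\<^sub>0" using fin by blast
    have "1 \<le> (\<omega> j)\<^sup>2" using \<omega> j sub by (auto intro: one_le_power)
    then show ?thesis using \<omega>s[OF j] by simp
  qed
  \<comment> \<open>The event is fixed before \<open>x\<close>, \<open>\<tau>\<close> and
    \<open>x'\<close> are introduced, so a single event serves all functions and all
    minimizers.\<close>
  obtain E where E: "E \<in> sets ?P" "1 - \<gamma> < measure ?P E"
    and iso: "\<And>t x. t \<in> E \<Longrightarrow> (\<Sum>j\<in>\<Lambda>\<^sub>0. \<omega> j * cmod (x j)) \<le> 3 * sqrt s * sqrt (\<Sum>j\<in>\<Lambda>\<^sub>0. (cmod (x j))\<^sup>2) \<Longrightarrow>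
      9 / 1024 * m * (\<Sum>j\<in>\<Lambda>\<^sub>0. (cmod (x j))\<^sup>2) \<le> (\<Sum>l<m. (cmod (\<Sum>j\<in>\<Lambda>\<^sub>0. x j * \<psi> j (t l)))\<^sup>2)"
  proof -
    have "\<exists>E\<in>sets ?P. 1 - \<gamma> < measure ?P E \<and> (\<forall>t\<in>E. \<forall>x.
        (\<Sum>j\<in>\<Lambda>\<^sub>0. \<omega> j * cmod (x j)) \<le> 3 * sqrt s * sqrt (\<Sum>j\<in>\<Lambda>\<^sub>0. (cmod (x j))\<^sup>2) \<longrightarrow>
        9 / 1024 * m * (\<Sum>j\<in>\<Lambda>\<^sub>0. (cmod (x j))\<^sup>2) \<le> (\<Sum>l<m. (cmod (\<Sum>j\<in>\<Lambda>\<^sub>0. x j * \<psi> j (t l)))\<^sup>2))"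
    proof (rule lower_isometry_on_cone[OF M])
      show "\<psi> j \<in> borel_measurable \<nu>" "0 < \<omega> j" "(\<omega> j)\<^sup>2 \<le> s" if "j \<in> \<Lambda>\<^sub>0" for j
        using that sub mes \<omega>[of j] \<omega>s[of j] zero_le_power2[of "\<omega> j"] by auto
      show "cmod (\<psi> j u) \<le> \<omega> j" if "j \<in> \<Lambda>\<^sub>0" "u \<in> space \<nu>" for j u
        using that sub \<psi> D by auto
      show "(\<integral>u. \<psi> j u * cnj (\<psi> k u) \<partial>\<nu>) = (if j = k then 1 else 0)" if "j \<in> \<Lambda>\<^sub>0" "k \<in> \<Lambda>\<^sub>0" for j k
        using that sub orth by blast
    qed (use fin \<gamma> s4 m N in auto)
    then show thesis using that by blast
  qed
  show "\<exists>E \<in> sets ?P. measure ?P E > 1 - \<gamma> \<and>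
        (\<forall>t\<in>E. \<forall>x :: nat \<Rightarrow> complex. weighted_norm_finite \<Lambda> v p x \<longrightarrow>
          (let f = expansion \<Lambda> \<psi> x;
               f_norm = weighted_norm \<Lambda> v p x;
               y = (\<lambda>l. f (t l));
               A = sampling_matrix \<psi> t
           in \<forall>\<tau>\<ge>1. \<forall>x' :: nat \<Rightarrow> complex.
                is_weighted_l1_solution m \<Lambda>\<^sub>0 \<omega> A y
                  (\<tau> * real s powr (1 / 2 - 1 / p) * sqrt (real m) * f_norm) x' \<longrightarrow>
                sup_norm D (\<lambda>u. f u - expansion \<Lambda>\<^sub>0 \<psi> x' u)
                  \<le> ennreal ((7 + 64 * \<tau>) * real s powr (1 - 1 / p) * f_norm)))"
    unfolding Let_def
  proof (intro bexI[OF _ E(1)] conjI E(2) ballI allI impI)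
    fix t and x :: "nat \<Rightarrow> complex" and \<tau> :: real and x' :: "nat \<Rightarrow> complex"
    assume tE: "t \<in> E" and x: "weighted_norm_finite \<Lambda> v p x" and \<tau>: "1 \<le> \<tau>"
      and x': "is_weighted_l1_solution m \<Lambda>\<^sub>0 \<omega> (sampling_matrix \<psi> t) (\<lambda>l. expansion \<Lambda> \<psi> x (t l))
        (\<tau> * real s powr (1 / 2 - 1 / p) * sqrt m * weighted_norm \<Lambda> v p x) x'"
    have "t \<in> space ?P" using tE sets.sets_into_space[OF E(1)] by blast
    then have t: "t l \<in> D" if "l < m" for l using that D by (auto simp: space_PiM PiE_def)
    \<comment> \<open>The confidence term alone forces at least one sample, even when
      \<open>ln N\<close> is 0.\<close>
    have "0 < ln (1 / \<gamma>)" using \<gamma> by simp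
    then have "0 < 10 ^ 9 * real s * max ((ln (real s)) ^ 3 * ln (real N)) (ln (1 / \<gamma>))"
      using s4 by (intro mult_pos_pos) (auto simp: less_max_iff_disj)
    then have m0: "0 < m" using m by linarith
    show "sup_norm D (\<lambda>u. expansion \<Lambda> \<psi> x u - expansion \<Lambda>\<^sub>0 \<psi> x' u)
        \<le> ennreal ((7 + 64 * \<tau>) * real s powr (1 - 1 / p) * weighted_norm \<Lambda> v p x)"
      unfolding sup_norm_def
    proof (intro SUP_least ennreal_leI)
      fix u assume "u \<in> D"
      then show "cmod (expansion \<Lambda> \<psi> x u - expansion \<Lambda>\<^sub>0 \<psi> x' u)
          \<le> (7 + 64 * \<tau>) * real s powr (1 - 1 / p) * weighted_norm \<Lambda> v p x"
        using p fin by (intro recovery_sup_norm[OF _ _ s m0 \<tau> \<omega> \<omega>v _ \<Lambda>\<^sub>0 \<psi> t iso[OF tE] x x']) auto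
    qed
  qed
qed auto

end
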